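(* Let $p:\widetilde C\to C$ be a covering morphism of crossed complexes. If $C$ is free on $X_*$, then $\widetilde C$ is free on $p^{-1}(X_* )$.
   Context: A crossed module over a groupoid $\Phi$ is a family of groups $M=(M(x))_{x\in Ob\,\Phi}$ with a groupoid morphism $\mu:M\to\Phi$, identity on objects, and a right action of $\Phi$ on $M$ ($m^u\in M(y)$ for $m\in M(x)$, $u\in\Phi(x,y)$) with $\mu(m^u)=u^{-1}\mu(m)u$ and $n^{-1}mn=m^{\mu n}$ (composites in groupoids are written $ab:x\to z$ for $a:x\to y$, $b:y\to z$). The free crossed $\Phi$-module on a family of functions $w:S(x)\to\Phi(x,x)$, $x\in Ob\,\Phi$, is the universal crossed $\Phi$-module $\mu:M\to\Phi$ with maps $S(x)\to M(x)$ lifting $w$. A crossed complex $C$ consists of a set $C_0$, a groupoid $C_1$ on $C_0$, families of groups $C_n=(C_n(x))_{x\in C_0}$ for $n\ge2$, right actions of $C_1$ on $C_n$ for $n\ge2$, and morphisms $\delta_n:C_n\to C_{n-1}$ ($n\ge2$) over the identity on $C_0$, such that: $\delta_2$ is a crossed module over $C_1$; for $n\ge3$, $C_n$ is a $C_1$-module (abelian) and $\delta_n$ preserves the action; $\delta_{n-1}\delta_n$ is trivial for $n\ge3$; $\delta_2C_2$ acts trivially on $C_n$ for $n\ge3$. The fundamental groupoid $\pi_1C$ is the quotient of $C_1$ by the totally disconnected normal subgroupoid $\delta_2C_2$; for $n\ge3$, $C_n$ is a $\pi_1C$-module. A morphism of crossed complexes is a family of maps $f_n:C_n\to D_n$ ($n\ge0$)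 preserving all the structure. A morphism $p:\widetilde C\to C$ of crossed complexes is a covering morphism if (i) $p_1:\widetilde C_1\to C_1$ is a covering morphism of groupoids, i.e. for each object $\tilde x$ the map from the set of arrows of $\widetilde C_1$ with source $\tilde x$ to the set of arrows of $C_1$ with source $p\tilde x$ is bijective; and (ii) for $n\ge2$ and $\tilde x\in\widetilde C_0$, $p_n:\widetilde C_n(\tilde x)\to C_n(p\tilde x)$ is an isomorphism of groups. $C$ is free on $X_*=(X_n)_{n\ge1}$ ($X_*$ is a free basis) if the $X_n$ are subgraphs of $C_n$ (sets of elements of $C_n$, together with all objects $C_0$) such that $C_1$ is the free groupoid on the graph $X_1$, $C_2$ is the free crossed $C_1$-module on the restriction $X_2\to C_1$ of $\delta_2$, and for $n\ge3$, $C_n$ is the free $\pi_1C$-module on $X_n$. $p^{-1}(X_* )$ denotes the family $p_n^{-1}(X_n)\subseteq\widetilde C_n$. *)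

theory Defs
  imports "HOL-Algebra.Group"
begin

section \<open>Groupoids\<close>

text \<open>Composition is written in diagrammatic order: for \<open>a : x \<rightarrow> y\<close> and \<open>b : y \<rightarrow> z\<close> the
  composite \<open>cmp G a b\<close> is an arrow \<open>x \<rightarrow> z\<close>.\<close>

record ('o, 'a) groupoid =
  Ob  :: "'o set"
  Ar  :: "'a set"
  src :: "'a \<Rightarrow> 'o"
  tgt :: "'a \<Rightarrow> 'o"
  cmp :: "'a \<Rightarrow> 'a \<Rightarrow> 'a"
  idt :: "'o \<Rightarrow> 'a"

definition is_ginv :: "('o, 'a) groupoid \<Rightarrow> 'a \<Rightarrow> 'a \<Rightarrow> bool" where
  "is_ginv G a b \<longleftrightarrow> b \<in> Ar G \<and> src G b = tgt G a \<and> tgt G b = src G a \<and>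
     cmp G a b = idt G (src G a) \<and> cmp G b a = idt G (tgt G a)"

definition ginv :: "('o, 'a) groupoid \<Rightarrow> 'a \<Rightarrow> 'a" where
  "ginv G a = (THE b. is_ginv G a b)"

locale groupoid =
  fixes G :: "('o, 'a) groupoid"
  assumes src_closed: "a \<in> Ar G \<Longrightarrow> src G a \<in> Ob G"
    and tgt_closed: "a \<in> Ar G \<Longrightarrow> tgt G a \<in> Ob G"
    and idt_closed: "x \<in> Ob G \<Longrightarrow> idt G x \<in> Ar G"
    and src_idt: "x \<in> Ob G \<Longrightarrow> src G (idt G x) = x"
    and tgt_idt: "x \<in> Ob G \<Longrightarrow> tgt G (idt G x) = x"
    and cmp_closed: "\<lbrakk>a \<in> Ar G; b \<in> Ar G; tgt G a = src G b\<rbrakk> \<Longrightarrow> cmp G a b \<in> Ar G"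
    and src_cmp: "\<lbrakk>a \<in> Ar G; b \<in> Ar G; tgt G a = src G b\<rbrakk> \<Longrightarrow> src G (cmp G a b) = src G a"
    and tgt_cmp: "\<lbrakk>a \<in> Ar G; b \<in> Ar G; tgt G a = src G b\<rbrakk> \<Longrightarrow> tgt G (cmp G a b) = tgt G b"
    and cmp_assoc: "\<lbrakk>a \<in> Ar G; b \<in> Ar G; c \<in> Ar G; tgt G a = src G b; tgt G b = src G c\<rbrakk>
          \<Longrightarrow> cmp G (cmp G a b) c = cmp G a (cmp G b c)"
    and idt_left: "a \<in> Ar G \<Longrightarrow> cmp G (idt G (src G a)) a = a"
    and idt_right: "a \<in> Ar G \<Longrightarrow> cmp G a (idt G (tgt G a)) = a"
    and ginv_ex: "a \<in> Ar G \<Longrightarrow> \<exists>b. is_ginv G a b"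

definition groupoid_hom ::
  "('o, 'a) groupoid \<Rightarrow> ('p, 'b) groupoid \<Rightarrow> ('o \<Rightarrow> 'p) \<Rightarrow> ('a \<Rightarrow> 'b) \<Rightarrow> bool" where
  "groupoid_hom G H f0 f1 \<longleftrightarrow>
     f0 \<in> Ob G \<rightarrow> Ob H \<and>
     f1 \<in> Ar G \<rightarrow> Ar H \<and>
     (\<forall>a\<in>Ar G. src H (f1 a) = f0 (src G a) \<and> tgt H (f1 a) = f0 (tgt G a)) \<and>
     (\<forall>x\<in>Ob G. f1 (idt G x) = idt H (f0 x)) \<and>
     (\<forall>a\<in>Ar G. \<forall>b\<in>Ar G. tgt G a = src G b \<longrightarrow> f1 (cmp G a b) = cmp H (f1 a) (f1 b))"

definition vertex_group :: "('o, 'a) groupoid \<Rightarrow> 'o \<Rightarrow> 'a monoid" where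
  "vertex_group G x =
     \<lparr>carrier = {a \<in> Ar G. src G a = x \<and> tgt G a = x}, mult = cmp G, one = idt G x\<rparr>"

definition groupoid_covering ::
  "('o, 'a) groupoid \<Rightarrow> ('p, 'b) groupoid \<Rightarrow> ('o \<Rightarrow> 'p) \<Rightarrow> ('a \<Rightarrow> 'b) \<Rightarrow> bool" where
  "groupoid_covering G H p0 p1 \<longleftrightarrow> groupoid_hom G H p0 p1 \<and>
     (\<forall>x\<in>Ob G. bij_betw p1 {a \<in> Ar G. src G a = x} {b \<in> Ar H. src H b = p0 x})"

text \<open>Quotient by a totally disconnected normal subgroupoid, given by its vertex groups \<open>N x\<close>.
  The arrows are the cosets \<open>N x \<cdot> u\<close> of the arrows \<open>u\<close> with source \<open>x\<close>.\<close>

definition gcoset :: "('o, 'a) groupoid \<Rightarrow> ('o \<Rightarrow> 'a set) \<Rightarrow> 'a \<Rightarrow> 'a set" where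
  "gcoset G N u = (\<lambda>n. cmp G n u) ` N (src G u)"

definition quotient_groupoid ::
  "('o, 'a) groupoid \<Rightarrow> ('o \<Rightarrow> 'a set) \<Rightarrow> ('o, 'a set) groupoid" where
  "quotient_groupoid G N =
     \<lparr>Ob = Ob G,
      Ar = gcoset G N ` Ar G,
      src = (\<lambda>U. the_elem (src G ` U)),
      tgt = (\<lambda>U. the_elem (tgt G ` U)),
      cmp = (\<lambda>U V. {cmp G u v |u v. u \<in> U \<and> v \<in> V}),
      idt = (\<lambda>x. gcoset G N (idt G x))\<rparr>"


section \<open>Modules and crossed modules over a groupoid\<close>

text \<open>A family of groups indexed by objects, with a right action of the arrows. For
  \<open>u : x \<rightarrow> y\<close> and \<open>m \<in> carrier (grp M x)\<close> the element \<open>m\<^sup>u\<close> of \<open>grp M y\<close> is \<open>act M m u\<close>. The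
  carriers at distinct objects may overlap: the object at which \<open>m\<close> is taken is always the
  source of \<open>u\<close>. For the same reason, maps out of a family take the object as an argument.\<close>

record ('o, 'a, 'm) gfamily =
  grp :: "'o \<Rightarrow> 'm monoid"
  act :: "'m \<Rightarrow> 'a \<Rightarrow> 'm"

locale groupoid_action = groupoid G for G :: "('o, 'a) groupoid" +
  fixes M :: "('o, 'a, 'm) gfamily"
  assumes grp_group: "x \<in> Ob G \<Longrightarrow> group (grp M x)"
    and act_hom: "u \<in> Ar G \<Longrightarrow> (\<lambda>m. act M m u) \<in> hom (grp M (src G u)) (grp M (tgt G u))"
    and act_idt: "\<lbrakk>x \<in> Ob G; m \<in> carrier (grp M x)\<rbrakk> \<Longrightarrow> act M m (idt G x) = m"
    and act_cmp: "\<lbrakk>u \<in> Ar G; v \<in> Ar G; tgt G u = src G v; m \<in> carrier (grp M (src G u))\<rbrakk>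
          \<Longrightarrow> act M m (cmp G u v) = act M (act M m u) v"

locale groupoid_module = groupoid_action G M
  for G :: "('o, 'a) groupoid" and M :: "('o, 'a, 'm) gfamily" +
  assumes grp_comm: "x \<in> Ob G \<Longrightarrow> comm_group (grp M x)"

locale crossed_module = groupoid_action G M
  for G :: "('o, 'a) groupoid" and M :: "('o, 'a, 'm) gfamily" +
  fixes \<mu> :: "'o \<Rightarrow> 'm \<Rightarrow> 'a"
  assumes bdry_hom: "x \<in> Ob G \<Longrightarrow> \<mu> x \<in> hom (grp M x) (vertex_group G x)"
    and bdry_act: "\<lbrakk>u \<in> Ar G; m \<in> carrier (grp M (src G u))\<rbrakk>
          \<Longrightarrow> \<mu> (tgt G u) (act M m u) = cmp G (cmp G (ginv G u) (\<mu> (src G u) m)) u"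
    and peiffer: "\<lbrakk>x \<in> Ob G; m \<in> carrier (grp M x); n \<in> carrier (grp M x)\<rbrakk>
          \<Longrightarrow> inv\<^bsub>grp M x\<^esub> n \<otimes>\<^bsub>grp M x\<^esub> m \<otimes>\<^bsub>grp M x\<^esub> n = act M m (\<mu> x n)"

definition gfamily_hom :: "('o, 'a) groupoid \<Rightarrow> ('o, 'a, 'm) gfamily \<Rightarrow> ('o, 'a, 'n) gfamily
    \<Rightarrow> ('o \<Rightarrow> 'm \<Rightarrow> 'n) \<Rightarrow> bool" where
  "gfamily_hom G M N f \<longleftrightarrow>
     (\<forall>x\<in>Ob G. f x \<in> hom (grp M x) (grp N x)) \<and>
     (\<forall>u\<in>Ar G. \<forall>m\<in>carrier (grp M (src G u)).
        f (tgt G u) (act M m u) = act N (f (src G u) m) u)"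

definition crossed_module_hom :: "('o, 'a) groupoid \<Rightarrow>
    ('o, 'a, 'm) gfamily \<Rightarrow> ('o \<Rightarrow> 'm \<Rightarrow> 'a) \<Rightarrow>
    ('o, 'a, 'n) gfamily \<Rightarrow> ('o \<Rightarrow> 'n \<Rightarrow> 'a) \<Rightarrow> ('o \<Rightarrow> 'm \<Rightarrow> 'n) \<Rightarrow> bool" where
  "crossed_module_hom G M \<mu> N \<nu> f \<longleftrightarrow> gfamily_hom G M N f \<and>
     (\<forall>x\<in>Ob G. \<forall>m\<in>carrier (grp M x). \<nu> x (f x m) = \<mu> x m)"


section \<open>Crossed complexes\<close>

text \<open>\<open>base C\<close> is the groupoid \<open>C\<^sub>1\<close> on the set \<open>C\<^sub>0\<close>; \<open>fam C n\<close> is the family \<open>C\<^sub>n\<close> with its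
  \<open>C\<^sub>1\<close>-action, meaningful for \<open>n \<ge> 2\<close>; \<open>bd2 C\<close> is \<open>\<delta>\<^sub>2\<close>, and \<open>bd C n\<close> is \<open>\<delta>\<^sub>n\<close>, meaningful
  for \<open>n \<ge> 3\<close>. All the groups in dimensions at least 2 share one element type, which is no
  restriction, as their carriers are arbitrary.\<close>

record ('o, 'a, 'm) crossed_complex =
  base :: "('o, 'a) groupoid"
  fam  :: "nat \<Rightarrow> ('o, 'a, 'm) gfamily"
  bd2  :: "'o \<Rightarrow> 'm \<Rightarrow> 'a"
  bd   :: "nat \<Rightarrow> 'o \<Rightarrow> 'm \<Rightarrow> 'm"

abbreviation cgrp :: "('o, 'a, 'm) crossed_complex \<Rightarrow> nat \<Rightarrow> 'o \<Rightarrow> 'm monoid" where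
  "cgrp C n x \<equiv> grp (fam C n) x"

abbreviation cact :: "('o, 'a, 'm) crossed_complex \<Rightarrow> nat \<Rightarrow> 'm \<Rightarrow> 'a \<Rightarrow> 'm" where
  "cact C n m u \<equiv> act (fam C n) m u"

locale crossed_complex =
  fixes C :: "('o, 'a, 'm) crossed_complex"
  assumes base_groupoid: "groupoid (base C)"
    and dim2_crossed_module: "crossed_module (base C) (fam C 2) (bd2 C)"
    and dim_ge3_module: "n \<ge> 3 \<Longrightarrow> groupoid_module (base C) (fam C n)"
    and bd_hom: "n \<ge> 3 \<Longrightarrow> gfamily_hom (base C) (fam C n) (fam C (n - 1)) (bd C n)"
    and bd2_bd3: "\<lbrakk>x \<in> Ob (base C); c \<in> carrier (cgrp C 3 x)\<rbrakk>
          \<Longrightarrow> bd2 C x (bd C 3 x c) = idt (base C) x"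
    and bd_bd: "\<lbrakk>n \<ge> 4; x \<in> Ob (base C); c \<in> carrier (cgrp C n x)\<rbrakk>
          \<Longrightarrow> bd C (n - 1) x (bd C n x c) = \<one>\<^bsub>cgrp C (n - 2) x\<^esub>"
    and bd2_act_trivial: "\<lbrakk>n \<ge> 3; x \<in> Ob (base C); c \<in> carrier (cgrp C n x);
            m \<in> carrier (cgrp C 2 x)\<rbrakk> \<Longrightarrow> cact C n c (bd2 C x m) = c"

definition fundamental_groupoid :: "('o, 'a, 'm) crossed_complex \<Rightarrow> ('o, 'a set) groupoid" where
  "fundamental_groupoid C = quotient_groupoid (base C) (\<lambda>x. bd2 C x ` carrier (cgrp C 2 x))"

text \<open>\<open>C\<^sub>n\<close> as a family over \<open>\<pi>\<^sub>1 C\<close>. For \<open>n \<ge> 3\<close> the value \<open>m\<^sup>u\<close> is the same for all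
  representatives \<open>u\<close> of an arrow of \<open>\<pi>\<^sub>1 C\<close>, so \<open>the_elem\<close> is applied to a singleton.\<close>

definition pi1_family :: "('o, 'a, 'm) crossed_complex \<Rightarrow> nat \<Rightarrow> ('o, 'a set, 'm) gfamily" where
  "pi1_family C n = \<lparr>grp = grp (fam C n), act = (\<lambda>m U. the_elem ((\<lambda>u. cact C n m u) ` U))\<rparr>"

record ('o, 'a, 'm, 'p, 'b, 'n) cc_map =
  map0 :: "'o \<Rightarrow> 'p"
  map1 :: "'a \<Rightarrow> 'b"
  mapn :: "nat \<Rightarrow> 'o \<Rightarrow> 'm \<Rightarrow> 'n"

definition cc_morphism :: "('o, 'a, 'm) crossed_complex \<Rightarrow> ('p, 'b, 'n) crossed_complex
    \<Rightarrow> ('o, 'a, 'm, 'p, 'b, 'n) cc_map \<Rightarrow> bool" where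
  "cc_morphism C D f \<longleftrightarrow>
     crossed_complex C \<and> crossed_complex D \<and>
     groupoid_hom (base C) (base D) (map0 f) (map1 f) \<and>
     (\<forall>n\<ge>2. \<forall>x\<in>Ob (base C). mapn f n x \<in> hom (cgrp C n x) (cgrp D n (map0 f x))) \<and>
     (\<forall>n\<ge>2. \<forall>u\<in>Ar (base C). \<forall>m\<in>carrier (cgrp C n (src (base C) u)).
        mapn f n (tgt (base C) u) (cact C n m u) =
          cact D n (mapn f n (src (base C) u) m) (map1 f u)) \<and>
     (\<forall>x\<in>Ob (base C). \<forall>m\<in>carrier (cgrp C 2 x).
        map1 f (bd2 C x m) = bd2 D (map0 f x) (mapn f 2 x m)) \<and>
     (\<forall>n\<ge>3. \<forall>x\<in>Ob (base C). \<forall>m\<in>carrier (cgrp C n x).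
        mapn f (n - 1) x (bd C n x m) = bd D n (map0 f x) (mapn f n x m))"

definition cc_covering :: "('o, 'a, 'm) crossed_complex \<Rightarrow> ('p, 'b, 'n) crossed_complex
    \<Rightarrow> ('o, 'a, 'm, 'p, 'b, 'n) cc_map \<Rightarrow> bool" where
  "cc_covering C D p \<longleftrightarrow>
     cc_morphism C D p \<and>
     groupoid_covering (base C) (base D) (map0 p) (map1 p) \<and>
     (\<forall>n\<ge>2. \<forall>x\<in>Ob (base C). mapn p n x \<in> iso (cgrp C n x) (cgrp D n (map0 p x)))"


section \<open>Freeness\<close>

text \<open>The universal properties quantify over test objects whose elements are taken from a type
  \<open>'u\<close>, the universe, which is a parameter because a formula of HOL cannot quantify over types.\<close>

definition free_groupoid_on :: "'u itself \<Rightarrow> ('o, 'a) groupoid \<Rightarrow> 'a set \<Rightarrow> bool" where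
  "free_groupoid_on U G X \<longleftrightarrow>
     groupoid G \<and> X \<subseteq> Ar G \<and>
     (\<forall>(H :: ('u, 'u) groupoid) f0 f.
        groupoid H \<and> f0 \<in> Ob G \<rightarrow> Ob H \<and> f \<in> X \<rightarrow> Ar H \<and>
        (\<forall>a\<in>X. src H (f a) = f0 (src G a) \<and> tgt H (f a) = f0 (tgt G a)) \<longrightarrow>
        (\<exists>F. groupoid_hom G H f0 F \<and> (\<forall>a\<in>X. F a = f a) \<and>
           (\<forall>F'. groupoid_hom G H f0 F' \<and> (\<forall>a\<in>X. F' a = f a) \<longrightarrow> (\<forall>a\<in>Ar G. F' a = F a))))"

text \<open>\<open>(M, \<mu>)\<close> is the free crossed \<open>G\<close>-module on \<open>w x : S x \<rightarrow> G(x, x)\<close>, with structure maps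
  \<open>i x : S x \<rightarrow> M(x)\<close>.\<close>

definition free_crossed_module_on :: "'u itself \<Rightarrow> ('o, 'a) groupoid \<Rightarrow>
    ('o \<Rightarrow> 's set) \<Rightarrow> ('o \<Rightarrow> 's \<Rightarrow> 'a) \<Rightarrow>
    ('o, 'a, 'm) gfamily \<Rightarrow> ('o \<Rightarrow> 'm \<Rightarrow> 'a) \<Rightarrow> ('o \<Rightarrow> 's \<Rightarrow> 'm) \<Rightarrow> bool" where
  "free_crossed_module_on U G S w M \<mu> i \<longleftrightarrow>
     crossed_module G M \<mu> \<and>
     (\<forall>x\<in>Ob G. \<forall>s\<in>S x. w x s \<in> carrier (vertex_group G x)) \<and>
     (\<forall>x\<in>Ob G. \<forall>s\<in>S x. i x s \<in> carrier (grp M x) \<and> \<mu> x (i x s) = w x s) \<and>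
     (\<forall>(N :: ('o, 'a, 'u) gfamily) \<nu> g.
        crossed_module G N \<nu> \<and>
        (\<forall>x\<in>Ob G. \<forall>s\<in>S x. g x s \<in> carrier (grp N x) \<and> \<nu> x (g x s) = w x s) \<longrightarrow>
        (\<exists>F. crossed_module_hom G M \<mu> N \<nu> F \<and> (\<forall>x\<in>Ob G. \<forall>s\<in>S x. F x (i x s) = g x s) \<and>
           (\<forall>F'. crossed_module_hom G M \<mu> N \<nu> F' \<and>
                 (\<forall>x\<in>Ob G. \<forall>s\<in>S x. F' x (i x s) = g x s) \<longrightarrow>
              (\<forall>x\<in>Ob G. \<forall>m\<in>carrier (grp M x). F' x m = F x m))))"

definition free_module_on :: "'u itself \<Rightarrow> ('o, 'a) groupoid \<Rightarrow>
    ('o, 'a, 'm) gfamily \<Rightarrow> ('o \<Rightarrow> 'm set) \<Rightarrow> bool" where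
  "free_module_on U G M X \<longleftrightarrow>
     groupoid_module G M \<and>
     (\<forall>x\<in>Ob G. X x \<subseteq> carrier (grp M x)) \<and>
     (\<forall>(N :: ('o, 'a, 'u) gfamily) g.
        groupoid_module G N \<and> (\<forall>x\<in>Ob G. g x \<in> X x \<rightarrow> carrier (grp N x)) \<longrightarrow>
        (\<exists>F. gfamily_hom G M N F \<and> (\<forall>x\<in>Ob G. \<forall>s\<in>X x. F x s = g x s) \<and>
           (\<forall>F'. gfamily_hom G M N F' \<and> (\<forall>x\<in>Ob G. \<forall>s\<in>X x. F' x s = g x s) \<longrightarrow>
              (\<forall>x\<in>Ob G. \<forall>m\<in>carrier (grp M x). F' x m = F x m))))"

text \<open>\<open>gens1 X\<close> is the set of arrows of \<open>X\<^sub>1\<close>; \<open>gens X n x\<close> is the part of \<open>X\<^sub>n\<close> lying in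
  \<open>C\<^sub>n(x)\<close>, for \<open>n \<ge> 2\<close>.\<close>

record ('o, 'a, 'm) cc_basis =
  gens1 :: "'a set"
  gens  :: "nat \<Rightarrow> 'o \<Rightarrow> 'm set"

definition free_cc_on :: "'u itself \<Rightarrow> ('o, 'a, 'm) crossed_complex \<Rightarrow> ('o, 'a, 'm) cc_basis
    \<Rightarrow> bool" where
  "free_cc_on U C X \<longleftrightarrow>
     crossed_complex C \<and>
     free_groupoid_on U (base C) (gens1 X) \<and>
     free_crossed_module_on U (base C) (gens X 2) (bd2 C) (fam C 2) (bd2 C) (\<lambda>x s. s) \<and>
     (\<forall>n\<ge>3. free_module_on U (fundamental_groupoid C) (pi1_family C n) (gens X n))"

definition cc_preimage :: "('o, 'a, 'm) crossed_complex \<Rightarrow> ('o, 'a, 'm, 'p, 'b, 'n) cc_map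
    \<Rightarrow> ('p, 'b, 'n) cc_basis \<Rightarrow> ('o, 'a, 'm) cc_basis" where
  "cc_preimage C p X =
     \<lparr>gens1 = {a \<in> Ar (base C). map1 p a \<in> gens1 X},
      gens = (\<lambda>n x. {m \<in> carrier (cgrp C n x). mapn p n x m \<in> gens X n (map0 p x)})\<rparr>"

text \<open>A universe large enough to decide freeness of a crossed complex of type
  \<open>('o, 'a, 'm) crossed_complex\<close>: the free groupoid, free crossed module and free modules on given
  generators consist of classes of words in elements of \<open>'o\<close>, \<open>'a\<close> and \<open>'m\<close>, so they have copies
  here, as do the components of the complex itself. Hence \<open>free_cc_on\<close> for this universe
  implies \<open>free_cc_on\<close> for every other one.\<close>

type_synonym ('o, 'a, 'm) word_universe = "('o + 'a + 'm) list set"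

end

(* A covering lets us coinduce: from a test object N over the covering groupoid G', the families
   (n_y), y running over the fibre above x, form a test object over G (over an arrow a for groupoids,
   over a common boundary a in G(x,x) for crossed modules), and morphisms into it are the same as
   morphisms into N of the structure pulled back along the covering. So the universal property over
   G gives existence over G', while uniqueness holds because the basis generates: the inclusion of
   the generated substructure is split by freeness, hence onto. Coinduced objects live in
   arbitrarily large types; but the part of a test object generated by the images of the basis
   consists of values of words, and n is determined by the set of words with value n, so this part
   has a copy in the word universe. *)

theory Submission
  imports Defs
begin

section \<open>Groupoids and their coverings\<close>

text \<open>The freeness of \<open>C\<close> speaks only of test objects in one type, so
  transporting a generated part into that type gives uniqueness only among morphisms with values in
  this part. Uniqueness is therefore obtained by another route: two morphisms agree on a
  substructure, and a substructure containing the basis is everything. A test groupoid may moreover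
  have objects without any code, and its map on objects need not be injective; it is pulled back to
  the objects of the free groupoid before words are formed. In dimensions at least 3, freeness is
  over the fundamental groupoid and not over \<open>base C\<close>. Such modules are read as crossed
  modules over \<open>base C\<close> with trivial boundary on which the image of \<open>bd2\<close>
  acts trivially, so that the one covering in dimension 1 serves every dimension and no covering of
  fundamental groupoids has to be constructed. The trivial action survives coinduction because the
  maps in dimension 2 are isomorphisms: an element of the image of \<open>bd2 C\<close> lifts to a
  loop in the image of \<open>bd2 C'\<close>. Fibres may be empty, so a coinduced element has to
  record the arrow that it lies over.\<close>

context groupoid
begin

lemma is_ginv_ginv:
  assumes a: "a \<in> Ar G"
  shows "is_ginv G a (ginv G a)"
proof -
  obtain b where b: "is_ginv G a b" using ginv_ex[OF a] by blast
  have "c = b" if c: "is_ginv G a c" for c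
  proof -
    have "c = cmp G c (cmp G a b)"
      using a b c idt_right[of c] unfolding is_ginv_def by auto
    also have "\<dots> = cmp G (cmp G c a) b"
      using a b c cmp_assoc[of c a b] unfolding is_ginv_def by auto
    also have "\<dots> = b"
      using a b c idt_left[of b] unfolding is_ginv_def by auto
    finally show ?thesis .
  qed
  with b show ?thesis unfolding ginv_def by (metis theI)
qed

lemma ginv_closed: "a \<in> Ar G \<Longrightarrow> ginv G a \<in> Ar G"
  and src_ginv: "a \<in> Ar G \<Longrightarrow> src G (ginv G a) = tgt G a"
  and tgt_ginv: "a \<in> Ar G \<Longrightarrow> tgt G (ginv G a) = src G a"
  and cmp_ginv_right: "a \<in> Ar G \<Longrightarrow> cmp G a (ginv G a) = idt G (src G a)"
  and cmp_ginv_left: "a \<in> Ar G \<Longrightarrow> cmp G (ginv G a) a = idt G (tgt G a)"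
  using is_ginv_ginv unfolding is_ginv_def by auto

lemmas gsimps = src_closed tgt_closed idt_closed src_idt tgt_idt cmp_closed src_cmp tgt_cmp
  idt_left idt_right ginv_closed src_ginv tgt_ginv cmp_ginv_left cmp_ginv_right

lemma idt_left': "\<lbrakk>a \<in> Ar G; src G a = x\<rbrakk> \<Longrightarrow> cmp G (idt G x) a = a"
  and idt_right': "\<lbrakk>a \<in> Ar G; tgt G a = x\<rbrakk> \<Longrightarrow> cmp G a (idt G x) = a"
  using idt_left idt_right by auto

lemma cmp_ginv_left_cancel:
  "\<lbrakk>a \<in> Ar G; b \<in> Ar G; tgt G a = src G b\<rbrakk> \<Longrightarrow> cmp G (ginv G a) (cmp G a b) = b"
  by (metis cmp_assoc cmp_ginv_left ginv_closed idt_left tgt_ginv)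

lemma cmp_ginv_right_cancel:
  "\<lbrakk>a \<in> Ar G; b \<in> Ar G; src G a = src G b\<rbrakk> \<Longrightarrow> cmp G a (cmp G (ginv G a) b) = b"
  by (metis cmp_assoc cmp_ginv_right ginv_closed idt_left src_ginv tgt_ginv)

lemma ginv_eqI:
  assumes "a \<in> Ar G" "b \<in> Ar G" "tgt G a = src G b" "cmp G a b = idt G (src G a)"
  shows "ginv G a = b"
  by (metis assms cmp_ginv_left_cancel ginv_closed idt_right tgt_ginv)

lemma ginv_cmp:
  assumes "a \<in> Ar G" "b \<in> Ar G" "tgt G a = src G b"
  shows "ginv G (cmp G a b) = cmp G (ginv G b) (ginv G a)"
  by (rule ginv_eqI) (use assms in \<open>simp_all add: gsimps cmp_assoc cmp_ginv_right_cancel\<close>)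

lemma ginv_idt: "x \<in> Ob G \<Longrightarrow> ginv G (idt G x) = idt G x"
  by (rule ginv_eqI) (simp_all add: gsimps idt_left')

lemma ginv_ginv: "a \<in> Ar G \<Longrightarrow> ginv G (ginv G a) = a"
  by (rule ginv_eqI) (simp_all add: gsimps)

lemma groupoid_hom_id: "groupoid_hom G G (\<lambda>x. x) (\<lambda>a. a)"
  by (simp add: groupoid_hom_def)

lemma vertex_group_group:
  assumes x: "x \<in> Ob G"
  shows "group (vertex_group G x)"
proof (rule groupI)
  fix a assume "a \<in> carrier (vertex_group G x)"
  then show "\<exists>b\<in>carrier (vertex_group G x). b \<otimes>\<^bsub>vertex_group G x\<^esub> a = \<one>\<^bsub>vertex_group G x\<^esub>"
    by (intro bexI[of _ "ginv G a"]) (auto simp: vertex_group_def gsimps)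
qed (use x in \<open>auto simp: vertex_group_def gsimps idt_left' cmp_assoc\<close>)

lemma vertex_group_inv:
  assumes "a \<in> carrier (vertex_group G x)"
  shows "inv\<^bsub>vertex_group G x\<^esub> a = ginv G a"
proof -
  have "x \<in> Ob G" using assms src_closed by (auto simp: vertex_group_def)
  then interpret group "vertex_group G x" by (rule vertex_group_group)
  show ?thesis
    by (rule inv_equality) (use assms in \<open>auto simp: vertex_group_def gsimps\<close>)
qed

end

lemma groupoid_homD:
  assumes "groupoid_hom G H f0 f1"
  shows "x \<in> Ob G \<Longrightarrow> f0 x \<in> Ob H" "a \<in> Ar G \<Longrightarrow> f1 a \<in> Ar H"
    "a \<in> Ar G \<Longrightarrow> src H (f1 a) = f0 (src G a)" "a \<in> Ar G \<Longrightarrow> tgt H (f1 a) = f0 (tgt G a)"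
    "x \<in> Ob G \<Longrightarrow> f1 (idt G x) = idt H (f0 x)"
    "\<lbrakk>a \<in> Ar G; b \<in> Ar G; tgt G a = src G b\<rbrakk> \<Longrightarrow> f1 (cmp G a b) = cmp H (f1 a) (f1 b)"
  using assms unfolding groupoid_hom_def by auto

lemma groupoid_hom_ginv:
  assumes "groupoid G" "groupoid H" "groupoid_hom G H f0 f1" "a \<in> Ar G"
  shows "f1 (ginv G a) = ginv H (f1 a)"
proof -
  interpret G: groupoid G by fact
  interpret H: groupoid H by fact
  note hD = groupoid_homD[OF assms(3)]
  show ?thesis
    by (rule H.ginv_eqI[symmetric])
      (use assms(4) hD(6)[of a "ginv G a"] in \<open>simp_all add: hD(1-5) G.gsimps\<close>)
qed

section \<open>Subgroupoids, their copies in another type, and generation by a free basis\<close>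

definition wide_subgroupoid :: "('o, 'a) groupoid \<Rightarrow> 'a set \<Rightarrow> bool" where
  "wide_subgroupoid G D \<longleftrightarrow> D \<subseteq> Ar G \<and> (\<forall>x\<in>Ob G. idt G x \<in> D) \<and>
     (\<forall>a\<in>D. \<forall>b\<in>D. tgt G a = src G b \<longrightarrow> cmp G a b \<in> D) \<and> (\<forall>a\<in>D. ginv G a \<in> D)"

text \<open>Objects and arrows get independent codes, and \<open>inv_into\<close> decodes. Only the
  arrows in \<open>D\<close> have to fit into the target type, which is what allows \<open>H\<close>
  itself to be too large for it.\<close>

definition transport_groupoid ::
  "('o, 'a) groupoid \<Rightarrow> 'a set \<Rightarrow> ('o \<Rightarrow> 'p) \<Rightarrow> ('a \<Rightarrow> 'b) \<Rightarrow> ('p, 'b) groupoid" where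
  "transport_groupoid H D \<alpha> \<beta> =
     \<lparr>Ob = \<alpha> ` Ob H, Ar = \<beta> ` D,
      src = (\<lambda>a. \<alpha> (src H (inv_into D \<beta> a))), tgt = (\<lambda>a. \<alpha> (tgt H (inv_into D \<beta> a))),
      cmp = (\<lambda>a b. \<beta> (cmp H (inv_into D \<beta> a) (inv_into D \<beta> b))),
      idt = (\<lambda>x. \<beta> (idt H (inv_into (Ob H) \<alpha> x)))\<rparr>"

lemma groupoid_transport:
  assumes "groupoid H" "wide_subgroupoid H D" and inj: "inj_on \<alpha> (Ob H)" "inj_on \<beta> D"
  shows "groupoid (transport_groupoid H D \<alpha> \<beta>)" (is "groupoid ?T")
proof -
  interpret H: groupoid H by fact
  note sub = assms(2)[unfolded wide_subgroupoid_def]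
  have D: "a \<in> D \<Longrightarrow> a \<in> Ar H" for a using sub by auto
  have \<alpha>: "\<alpha> x = \<alpha> y \<longleftrightarrow> x = y" if "x \<in> Ob H" "y \<in> Ob H" for x y
    using inj that by (auto dest: inj_onD)
  have sel: "Ob ?T = \<alpha> ` Ob H" "Ar ?T = \<beta> ` D"
    "a \<in> D \<Longrightarrow> src ?T (\<beta> a) = \<alpha> (src H a)" "a \<in> D \<Longrightarrow> tgt ?T (\<beta> a) = \<alpha> (tgt H a)"
    "\<lbrakk>a \<in> D; b \<in> D\<rbrakk> \<Longrightarrow> cmp ?T (\<beta> a) (\<beta> b) = \<beta> (cmp H a b)"
    "x \<in> Ob H \<Longrightarrow> idt ?T (\<alpha> x) = \<beta> (idt H x)" for a b x
    using inj by (simp_all add: transport_groupoid_def)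
  have cl: "x \<in> Ob H \<Longrightarrow> idt H x \<in> D" "a \<in> D \<Longrightarrow> ginv H a \<in> D"
    "\<lbrakk>a \<in> D; b \<in> D; tgt H a = src H b\<rbrakk> \<Longrightarrow> cmp H a b \<in> D" for a b x
    using sub by auto
  show ?thesis
  proof
    fix a assume "a \<in> Ar ?T"
    then obtain b where "b \<in> D" "a = \<beta> b" by (auto simp: sel)
    then show "\<exists>b. is_ginv ?T a b"
      by (intro exI[of _ "\<beta> (ginv H b)"])
        (simp add: is_ginv_def sel D H.gsimps cl)
  qed (clarsimp simp: sel D H.gsimps \<alpha> cl H.cmp_assoc)+
qed

text \<open>The universal property is applied to the copy of \<open>D\<close> in \<open>'w\<close>
  and its result is decoded. Since the copy knows nothing of arrows outside \<open>D\<close>,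
  uniqueness comes out only among homomorphisms with values in \<open>D\<close>.\<close>

lemma free_groupoid_transport:
  fixes G :: "('o, 'a) groupoid" and H :: "('q, 'v) groupoid"
    and \<alpha> :: "'q \<Rightarrow> 'w" and \<beta> :: "'v \<Rightarrow> 'w"
  assumes free: "free_groupoid_on TYPE('w) G X" and H: "groupoid H" and sub: "wide_subgroupoid H D"
    and inj: "inj_on \<alpha> (Ob H)" "inj_on \<beta> D"
    and f0: "f0 \<in> Ob G \<rightarrow> Ob H" and f: "f \<in> X \<rightarrow> D"
    and ends: "\<And>a. a \<in> X \<Longrightarrow> src H (f a) = f0 (src G a) \<and> tgt H (f a) = f0 (tgt G a)"
  shows "\<exists>F. groupoid_hom G H f0 F \<and> F \<in> Ar G \<rightarrow> D \<and> (\<forall>a\<in>X. F a = f a) \<and>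
    (\<forall>F'. groupoid_hom G H f0 F' \<and> F' \<in> Ar G \<rightarrow> D \<and> (\<forall>a\<in>X. F' a = f a) \<longrightarrow> (\<forall>a\<in>Ar G. F' a = F a))"
proof -
  interpret H: groupoid H by fact
  interpret G: groupoid G using free by (simp add: free_groupoid_on_def)
  let ?T = "transport_groupoid H D \<alpha> \<beta>"
  note s = sub[unfolded wide_subgroupoid_def]
  have D: "a \<in> D \<Longrightarrow> a \<in> Ar H" for a using s by auto
  have \<alpha>: "\<alpha> x = \<alpha> y \<longleftrightarrow> x = y" if "x \<in> Ob H" "y \<in> Ob H" for x y
    using inj that by (auto dest: inj_onD)
  have sel: "Ob ?T = \<alpha> ` Ob H" "Ar ?T = \<beta> ` D"
    "a \<in> D \<Longrightarrow> src ?T (\<beta> a) = \<alpha> (src H a)" "a \<in> D \<Longrightarrow> tgt ?T (\<beta> a) = \<alpha> (tgt H a)"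
    "\<lbrakk>a \<in> D; b \<in> D\<rbrakk> \<Longrightarrow> cmp ?T (\<beta> a) (\<beta> b) = \<beta> (cmp H a b)"
    "x \<in> Ob H \<Longrightarrow> idt ?T (\<alpha> x) = \<beta> (idt H x)" for a b x
    using inj by (simp_all add: transport_groupoid_def)
  have cl: "x \<in> Ob H \<Longrightarrow> idt H x \<in> D"
    "\<lbrakk>a \<in> D; b \<in> D; tgt H a = src H b\<rbrakk> \<Longrightarrow> cmp H a b \<in> D" for a b x
    using s by auto
  have XA: "X \<subseteq> Ar G" using free by (simp add: free_groupoid_on_def)
  have "groupoid ?T" by (rule groupoid_transport) fact+
  moreover have "\<alpha> \<circ> f0 \<in> Ob G \<rightarrow> Ob ?T" using f0 by (auto simp: sel)
  moreover have "\<beta> \<circ> f \<in> X \<rightarrow> Ar ?T" using f by (auto simp: sel)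
  moreover have "\<forall>a\<in>X. src ?T ((\<beta> \<circ> f) a) = (\<alpha> \<circ> f0) (src G a) \<and> tgt ?T ((\<beta> \<circ> f) a) = (\<alpha> \<circ> f0) (tgt G a)"
    using f ends by (auto simp: sel Pi_iff)
  ultimately obtain F where F: "groupoid_hom G ?T (\<alpha> \<circ> f0) F" "\<And>a. a \<in> X \<Longrightarrow> F a = \<beta> (f a)"
    and uniq: "\<And>F' a. \<lbrakk>groupoid_hom G ?T (\<alpha> \<circ> f0) F'; \<forall>a\<in>X. F' a = \<beta> (f a); a \<in> Ar G\<rbrakk> \<Longrightarrow> F' a = F a"
    using free[unfolded free_groupoid_on_def, THEN conjunct2, THEN conjunct2, rule_format, of ?T "\<alpha> \<circ> f0" "\<beta> \<circ> f"]
    by (auto simp: comp_def)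
  note FD = groupoid_homD[OF F(1), unfolded comp_def]
  define F1 where "F1 = inv_into D \<beta> \<circ> F"
  have F1D: "F1 a \<in> D" and F1: "\<beta> (F1 a) = F a" if "a \<in> Ar G" for a
    using FD(2)[OF that] inv_into_into[of "F a" \<beta> D] f_inv_into_f[of "F a" \<beta> D]
    by (simp_all add: F1_def sel)
  have \<beta>: "a = b" if "\<beta> a = \<beta> b" "a \<in> D" "b \<in> D" for a b
    using inj that by (auto dest: inj_onD)
  have f0': "f0 x \<in> Ob H" if "x \<in> Ob G" for x using f0 that by auto
  have "groupoid_hom G H f0 F1"
    unfolding groupoid_hom_def
  proof (intro conjI ballI impI)
    show 1: "src H (F1 a) = f0 (src G a)" if "a \<in> Ar G" for a
      using FD(3)[OF that] F1D[OF that] \<alpha> f0' that by (simp add: F1[symmetric] sel D H.gsimps G.gsimps)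
    show 2: "tgt H (F1 a) = f0 (tgt G a)" if "a \<in> Ar G" for a
      using FD(4)[OF that] F1D[OF that] \<alpha> f0' that by (simp add: F1[symmetric] sel D H.gsimps G.gsimps)
    show "F1 (idt G x) = idt H (f0 x)" if "x \<in> Ob G" for x
      by (rule \<beta>) (use that in \<open>simp_all add: F1 F1D cl f0' G.gsimps FD sel\<close>)
    show "F1 (cmp G a b) = cmp H (F1 a) (F1 b)" if "a \<in> Ar G" "b \<in> Ar G" "tgt G a = src G b" for a b
      by (rule \<beta>) (use that in \<open>simp_all add: F1 F1D cl f0' G.gsimps FD(6) 1 2 flip: sel(5)\<close>)
  qed (use f0 F1D D in auto)
  moreover have "F1 a = f a" if "a \<in> X" for a
    by (rule \<beta>) (use that F(2) f XA F1 F1D in \<open>auto simp: subset_eq\<close>)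
  moreover have "F' a = F1 a" if F': "groupoid_hom G H f0 F'" "F' \<in> Ar G \<rightarrow> D" "\<forall>a\<in>X. F' a = f a" "a \<in> Ar G" for F' a
  proof (rule \<beta>)
    have F'D: "a \<in> Ar G \<Longrightarrow> F' a \<in> D" for a using F'(2) by auto
    note D' = groupoid_homD[OF F'(1)]
    have "groupoid_hom G ?T (\<alpha> \<circ> f0) (\<beta> \<circ> F')"
      unfolding groupoid_hom_def using f0' F'D by (auto simp: sel D')
    then show "\<beta> (F' a) = \<beta> (F1 a)"
      using uniq[of "\<beta> \<circ> F'" a] F' F1 by simp
  qed (use F' F1D in auto)
  ultimately show ?thesis using F1D by (intro exI[of _ F1]) blast
qed

text \<open>The inclusion of the subgroupoid is a retraction by freeness, hence onto.\<close>

lemma free_groupoid_generated: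
  fixes G :: "('o, 'a) groupoid" and \<alpha> :: "'o \<Rightarrow> 'w" and \<beta> :: "'a \<Rightarrow> 'w"
  assumes free: "free_groupoid_on TYPE('w) G X" and inj: "inj \<alpha>" "inj \<beta>"
    and sub: "wide_subgroupoid G D" and X: "X \<subseteq> D"
  shows "D = Ar G"
proof
  show "D \<subseteq> Ar G" using sub by (simp add: wide_subgroupoid_def)
  interpret G: groupoid G using free by (simp add: free_groupoid_on_def)
  have i: "inj_on \<alpha> A" "inj_on \<beta> B" for A B using inj by (auto intro: inj_on_subset)
  have full: "wide_subgroupoid G (Ar G)" by (simp add: wide_subgroupoid_def G.gsimps)
  have X': "(\<lambda>a. a) \<in> X \<rightarrow> D" "(\<lambda>a. a) \<in> X \<rightarrow> Ar G" and id: "(\<lambda>x. x) \<in> Ob G \<rightarrow> Ob G"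
    using X \<open>D \<subseteq> Ar G\<close> by auto
  obtain F where F: "groupoid_hom G G (\<lambda>x. x) F" "F \<in> Ar G \<rightarrow> D" "\<forall>a\<in>X. F a = a"
    using free_groupoid_transport[OF free G.groupoid_axioms sub i id X'(1)] by auto
  \<comment> \<open>With the full subgroupoid in place of \<open>D\<close>, uniqueness applies both
    to \<open>F\<close> and to the identity: each equals \<open>F0\<close>.\<close>
  obtain F0 where "\<forall>F'. groupoid_hom G G (\<lambda>x. x) F' \<and> F' \<in> Ar G \<rightarrow> Ar G \<and> (\<forall>a\<in>X. F' a = a)
      \<longrightarrow> (\<forall>a\<in>Ar G. F' a = F0 a)"
    using free_groupoid_transport[OF free G.groupoid_axioms full i id X'(2)] by auto
  then have F0: "\<lbrakk>groupoid_hom G G (\<lambda>x. x) F'; F' \<in> Ar G \<rightarrow> Ar G; \<forall>a\<in>X. F' a = a; a \<in> Ar G\<rbrakk>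
      \<Longrightarrow> F' a = F0 a" for F' a
    by blast
  have "F a = a" if a: "a \<in> Ar G" for a
  proof -
    have "F \<in> Ar G \<rightarrow> Ar G" using groupoid_homD(2)[OF F(1)] by blast
    from F0[OF F(1) this F(3) a] have "F a = F0 a" .
    also have "F0 a = a" by (rule F0[OF G.groupoid_hom_id _ _ a, symmetric]) auto
    finally show ?thesis .
  qed
  then show "Ar G \<subseteq> D" using F(2) by (metis PiE subsetI)
qed

text \<open>\<open>groupoid_word f X w h\<close>: the word \<open>w\<close> evaluates to \<open>h\<close> when the letters from \<open>X\<close> are read
  through \<open>f\<close>. A letter preceded by a dummy \<open>Inl\<close> stands for itself, otherwise for its inverse.\<close>

inductive groupoid_word :: "('o, 'v) groupoid \<Rightarrow> ('a \<Rightarrow> 'v) \<Rightarrow> 'a set \<Rightarrow> ('o + 'a + 'm) list \<Rightarrow> 'v \<Rightarrow> bool"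
  for H f X where
  base: "x \<in> Ob H \<Longrightarrow> groupoid_word H f X [Inl x] (idt H x)"
| pos: "\<lbrakk>groupoid_word H f X w h; s \<in> X; tgt H (f s) = src H h\<rbrakk>
    \<Longrightarrow> groupoid_word H f X (Inl undefined # Inr (Inl s) # w) (cmp H (f s) h)"
| neg: "\<lbrakk>groupoid_word H f X w h; s \<in> X; src H (f s) = src H h\<rbrakk>
    \<Longrightarrow> groupoid_word H f X (Inr (Inl s) # w) (cmp H (ginv H (f s)) h)"

text \<open>The word dictates the last rule and its letter: a lone \<open>Inl\<close> is an
  identity, an \<open>Inl\<close> with more behind it is \<open>pos\<close>, an \<open>Inr\<close>
  in front is \<open>neg\<close>.\<close>

lemma groupoid_word_unique:
  "groupoid_word H f X w h \<Longrightarrow> groupoid_word H f X w h' \<Longrightarrow> h = h'"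
proof (induction arbitrary: h' rule: groupoid_word.induct)
  case (base x)
  then show ?case by (auto elim: groupoid_word.cases)
next
  case (pos w h s)
  from pos.prems show ?case
    by (cases rule: groupoid_word.cases) (use pos.IH in auto)
next
  case (neg w h s)
  from neg.prems show ?case
    by (cases rule: groupoid_word.cases) (use neg.IH in auto)
qed

text \<open>An element of the domain has at least one word, and this word alone recovers the
  element. Without the restriction, all elements that have no word would share the empty
  code.\<close>

lemma inj_on_codes:
  assumes "\<And>w h k. R w h \<Longrightarrow> R w k \<Longrightarrow> h = k"
  shows "inj_on (\<lambda>h. {w. R w h}) {h. \<exists>w. R w h}"
  unfolding inj_on_def set_eq_iff mem_Collect_eq using assms by blast

text \<open>Words grow only at the front. Closure under composition therefore goes by induction on
  the left factor, and inversion, which moves the first letter to the right end, is reduced to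
  composition.\<close>

lemma groupoid_words_wide_subgroupoid:
  assumes "groupoid H" and f: "f \<in> X \<rightarrow> Ar H"
  shows "wide_subgroupoid H {h. \<exists>w :: ('o + 'a + 'm) list. groupoid_word H f X w h}"
    and "s \<in> X \<Longrightarrow> \<exists>w :: ('o + 'a + 'm) list. groupoid_word H f X w (f s)"
proof -
  interpret H: groupoid H by fact
  have f': "s \<in> X \<Longrightarrow> f s \<in> Ar H" for s using f by auto
  let ?D = "\<lambda>h. \<exists>w :: ('o + 'a + 'm) list. groupoid_word H f X w h"
  have Ar: "groupoid_word H f X w h \<Longrightarrow> h \<in> Ar H" for w :: "('o + 'a + 'm) list" and h
    by (induction rule: groupoid_word.induct) (auto simp: H.gsimps f')
  have cmp: "?D k \<Longrightarrow> tgt H h = src H k \<Longrightarrow> ?D (cmp H h k)"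
    if "groupoid_word H f X w h" for w :: "('o + 'a + 'm) list" and h k
    using that
  proof (induction rule: groupoid_word.induct)
    case (base x)
    then show ?case by (metis Ar H.idt_left' H.tgt_idt)
  next
    case (pos w h s)
    note h = Ar[OF pos(1)] and s = f'[OF pos(2)]
    obtain v :: "('o + 'a + 'm) list" where v: "groupoid_word H f X v (cmp H h k)"
      using pos h s by (auto simp: H.gsimps)
    have "groupoid_word H f X (Inl undefined # Inr (Inl s) # v) (cmp H (f s) (cmp H h k))"
      by (rule groupoid_word.pos[OF v]) (use pos h s Ar in \<open>auto simp: H.gsimps\<close>)
    then show ?case using pos h s Ar by (auto simp: H.cmp_assoc H.gsimps)
  next
    case (neg w h s)
    note h = Ar[OF neg(1)] and s = f'[OF neg(2)]
    obtain v :: "('o + 'a + 'm) list" where v: "groupoid_word H f X v (cmp H h k)"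
      using neg h s by (auto simp: H.gsimps)
    have "groupoid_word H f X (Inr (Inl s) # v) (cmp H (ginv H (f s)) (cmp H h k))"
      by (rule groupoid_word.neg[OF v]) (use neg h s Ar in \<open>auto simp: H.gsimps\<close>)
    then show ?case using neg h s Ar by (auto simp: H.cmp_assoc H.gsimps)
  qed
  \<comment> \<open>A single letter becomes a word when it is followed by the identity at its far
    end.\<close>
  have gen: "?D (f s)" "?D (ginv H (f s))" if s: "s \<in> X" for s
  proof -
    have "groupoid_word H f X ([Inl undefined, Inr (Inl s), Inl (tgt H (f s))] :: ('o + 'a + 'm) list)
        (cmp H (f s) (idt H (tgt H (f s))))"
      by (intro groupoid_word.pos groupoid_word.base s) (use f'[OF s] in \<open>simp_all add: H.gsimps\<close>)
    then show "?D (f s)" using f'[OF s] by (auto simp: H.gsimps)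
    have "groupoid_word H f X ([Inr (Inl s), Inl (src H (f s))] :: ('o + 'a + 'm) list)
        (cmp H (ginv H (f s)) (idt H (src H (f s))))"
      by (intro groupoid_word.neg groupoid_word.base s) (use f'[OF s] in \<open>simp_all add: H.gsimps\<close>)
    then show "?D (ginv H (f s))" using f'[OF s] by (auto simp: H.gsimps H.idt_right')
  qed
  show "s \<in> X \<Longrightarrow> ?D (f s)" by (rule gen)
  have "?D (ginv H h)" if "groupoid_word H f X w h" for w :: "('o + 'a + 'm) list" and h
    using that
  proof (induction rule: groupoid_word.induct)
    case (base x)
    then have "groupoid_word H f X ([Inl x] :: ('o + 'a + 'm) list) (ginv H (idt H x))"
      by (simp add: H.ginv_idt groupoid_word.base)
    then show ?case ..
  next
    case (pos w h s)
    then show ?case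
      using cmp[of _ "ginv H h" "ginv H (f s)"] gen(2)[of s]
      by (auto simp: H.ginv_cmp f' Ar H.gsimps)
  next
    case (neg w h s)
    then show ?case
      using cmp[of _ "ginv H h" "f s"] gen(1)[of s]
      by (auto simp: H.ginv_cmp H.ginv_ginv f' Ar H.gsimps)
  qed
  then have inv: "?D h \<Longrightarrow> ?D (ginv H h)" for h by (elim exE)
  have idt: "?D (idt H x)" if "x \<in> Ob H" for x
    by (rule exI[of _ "[Inl x]"]) (rule groupoid_word.base[OF that])
  have cmp': "?D h \<Longrightarrow> ?D k \<Longrightarrow> tgt H h = src H k \<Longrightarrow> ?D (cmp H h k)" for h k
    by (elim exE, rule cmp) (assumption | rule exI)+
  have Ar': "?D h \<Longrightarrow> h \<in> Ar H" for h using Ar by (elim exE)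
  show "wide_subgroupoid H {h. ?D h}"
    unfolding wide_subgroupoid_def mem_Collect_eq subset_eq Ball_def
    by (intro conjI allI impI Ar' idt cmp' inv; assumption)
qed

text \<open>The pullback of \<open>H\<close> along \<open>f0\<close>: homomorphisms into
  \<open>H\<close> over \<open>f0\<close> correspond to homomorphisms into it over the identity of
  \<open>V\<close>. Its objects have the type of the objects of the free groupoid, as the letters
  for identities in a word require; the endpoints are stored in the arrows because \<open>f0\<close>
  may identify objects.\<close>

definition pullback_groupoid :: "'o set \<Rightarrow> ('o \<Rightarrow> 'q) \<Rightarrow> ('q, 'v) groupoid \<Rightarrow> ('o, 'o \<times> 'v \<times> 'o) groupoid" where
  "pullback_groupoid V f0 H =
     \<lparr>Ob = V, Ar = {(x, h, y). x \<in> V \<and> y \<in> V \<and> h \<in> Ar H \<and> src H h = f0 x \<and> tgt H h = f0 y},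
      src = fst, tgt = (\<lambda>t. snd (snd t)),
      cmp = (\<lambda>a b. (fst a, cmp H (fst (snd a)) (fst (snd b)), snd (snd b))),
      idt = (\<lambda>x. (x, idt H (f0 x), x))\<rparr>"

lemma groupoid_pullback:
  assumes "groupoid H" "f0 \<in> V \<rightarrow> Ob H"
  shows "groupoid (pullback_groupoid V f0 H)" (is "groupoid ?P")
proof -
  interpret H: groupoid H by fact
  have f0: "x \<in> V \<Longrightarrow> f0 x \<in> Ob H" for x using assms(2) by auto
  show ?thesis
  proof
    fix a assume "a \<in> Ar ?P"
    then show "\<exists>b. is_ginv ?P a b"
      by (intro exI[of _ "(snd (snd a), ginv H (fst (snd a)), fst a)"])
        (auto simp: pullback_groupoid_def is_ginv_def H.gsimps)
  qed (auto simp: pullback_groupoid_def H.gsimps H.cmp_assoc H.idt_left' H.idt_right' f0)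
qed

text \<open>The arrows on which \<open>F\<close> and \<open>F'\<close> agree form a wide subgroupoid
  containing the basis. This argument stays inside \<open>G\<close>, so the type of \<open>H\<close>
  is arbitrary.\<close>

lemma free_groupoid_hom_unique:
  fixes G :: "('o, 'a) groupoid"
  assumes free: "free_groupoid_on TYPE(('o, 'a, 'm) word_universe) G X"
    and H: "groupoid H" and F: "groupoid_hom G H f0 F" "groupoid_hom G H f0 F'"
    and X: "\<And>a. a \<in> X \<Longrightarrow> F a = F' a" and a: "a \<in> Ar G"
  shows "F a = F' a"
proof -
  interpret G: groupoid G using free by (simp add: free_groupoid_on_def)
  let ?D = "{a \<in> Ar G. F a = F' a}"
  have "wide_subgroupoid G ?D"
    unfolding wide_subgroupoid_def
    using F by (auto simp: G.gsimps groupoid_homD groupoid_hom_ginv[OF G.groupoid_axioms H])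
  moreover have "X \<subseteq> ?D" using X free by (auto simp: free_groupoid_on_def)
  \<comment> \<open>The two functions merely embed objects and arrows of \<open>G\<close> into the
    universe, as one-letter words.\<close>
  ultimately have "?D = Ar G"
    by (intro free_groupoid_generated[OF free, of "\<lambda>x. {[Inl x]}" "\<lambda>a. {[Inr (Inl a)]}"])
      (auto simp: inj_def)
  then show ?thesis using a by auto
qed

text \<open>Existence for test groupoids of any type: in the pullback, arrows generated by the
  images of the basis are coded by their sets of words, objects by one-letter words.\<close>

lemma free_groupoid_extend:
  fixes G :: "('o, 'a) groupoid" and H :: "('q, 'v) groupoid"
  assumes free: "free_groupoid_on TYPE(('o, 'a, 'm) word_universe) G X"
    and H: "groupoid H" and f0: "f0 \<in> Ob G \<rightarrow> Ob H" and f: "f \<in> X \<rightarrow> Ar H"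
    and ends: "\<And>a. a \<in> X \<Longrightarrow> src H (f a) = f0 (src G a) \<and> tgt H (f a) = f0 (tgt G a)"
  obtains F where "groupoid_hom G H f0 F" "\<And>a. a \<in> X \<Longrightarrow> F a = f a"
proof -
  interpret G: groupoid G using free by (simp add: free_groupoid_on_def)
  interpret H: groupoid H by fact
  have XA: "X \<subseteq> Ar G" using free by (simp add: free_groupoid_on_def)
  let ?P = "pullback_groupoid (Ob G) f0 H"
  let ?f = "\<lambda>a. (src G a, f a, tgt G a)"
  let ?D = "{h. \<exists>w :: ('o + 'a + 'm) list. groupoid_word ?P ?f X w h}"
  have P: "groupoid ?P" by (rule groupoid_pullback) fact+
  have f': "?f \<in> X \<rightarrow> Ar ?P"
    using f XA ends by (auto simp: pullback_groupoid_def G.gsimps)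
  have words: "wide_subgroupoid ?P ?D" "?f \<in> X \<rightarrow> ?D"
    using groupoid_words_wide_subgroupoid[OF P f'] by auto
  have inj1: "inj_on (\<lambda>x. {[Inl x] :: ('o + 'a + 'm) list}) (Ob ?P)"
    by (simp add: inj_on_def)
  have inj2: "inj_on (\<lambda>h. {w :: ('o + 'a + 'm) list. groupoid_word ?P ?f X w h}) ?D"
    by (rule inj_on_codes) (rule groupoid_word_unique)
  have id: "(\<lambda>x. x) \<in> Ob G \<rightarrow> Ob ?P"
    and ends': "src ?P (?f a) = src G a \<and> tgt ?P (?f a) = tgt G a" for a
    by (simp_all add: pullback_groupoid_def)
  obtain F where F: "groupoid_hom G ?P (\<lambda>x. x) F" "\<forall>a\<in>X. F a = ?f a"
    using free_groupoid_transport[OF free P words(1) inj1 inj2 id words(2) ends'] by blast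
  note FD = groupoid_homD[OF F(1)]
  \<comment> \<open>Forgetting the stored endpoints leads from the pullback back to
    \<open>H\<close>, with \<open>f0\<close> on objects.\<close>
  have "groupoid_hom G H f0 (\<lambda>a. fst (snd (F a)))"
    unfolding groupoid_hom_def
    using f0 FD(2) FD(3) FD(4) FD(5) FD(6)
    by (fastforce simp: pullback_groupoid_def Pi_iff)
  then show ?thesis using F(2) that by auto
qed

section \<open>Unique lifting of arrows, coinduced groupoids, and freeness of the covering
  groupoid\<close>

locale groupoid_cover = G': groupoid G' + G: groupoid G
  for G' :: "('p, 'b) groupoid" and G :: "('o, 'a) groupoid" +
  fixes p0 :: "'p \<Rightarrow> 'o" and p1 :: "'b \<Rightarrow> 'a"
  assumes covering: "groupoid_covering G' G p0 p1"
begin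

lemma hom: "groupoid_hom G' G p0 p1"
  using covering by (simp add: groupoid_covering_def)

lemmas homD = groupoid_homD[OF hom]

lemma p1_ginv: "a \<in> Ar G' \<Longrightarrow> p1 (ginv G' a) = ginv G (p1 a)"
  using groupoid_hom_ginv[OF G'.groupoid_axioms G.groupoid_axioms hom] .

lemma bij_star: "x \<in> Ob G' \<Longrightarrow> bij_betw p1 {a \<in> Ar G'. src G' a = x} {b \<in> Ar G. src G b = p0 x}"
  using covering by (simp add: groupoid_covering_def)

definition lift :: "'p \<Rightarrow> 'a \<Rightarrow> 'b" where
  "lift x b = inv_into {a \<in> Ar G'. src G' a = x} p1 b"

lemma lift:
  assumes "x \<in> Ob G'" "b \<in> Ar G" "src G b = p0 x"
  shows "lift x b \<in> Ar G'" "src G' (lift x b) = x" "p1 (lift x b) = b"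
    "p0 (tgt G' (lift x b)) = tgt G b"
proof -
  have b: "b \<in> p1 ` {a \<in> Ar G'. src G' a = x}"
    using bij_star[OF assms(1)] assms by (auto simp: bij_betw_def)
  show *: "lift x b \<in> Ar G'" "src G' (lift x b) = x" "p1 (lift x b) = b"
    using inv_into_into[OF b] f_inv_into_f[OF b] by (auto simp: lift_def)
  show "p0 (tgt G' (lift x b)) = tgt G b" using homD(4)[OF *(1)] * by simp
qed

lemma p1_inj: "\<lbrakk>a \<in> Ar G'; b \<in> Ar G'; src G' a = src G' b; p1 a = p1 b\<rbrakk> \<Longrightarrow> a = b"
  by (rule inj_onD[OF bij_betw_imp_inj_on[OF bij_star[OF G'.src_closed[of a]]]]) simp_all

lemma lift_p1: "\<lbrakk>a \<in> Ar G'; src G' a = x\<rbrakk> \<Longrightarrow> lift x (p1 a) = a"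
  unfolding lift_def
  by (rule inv_into_f_f[OF bij_betw_imp_inj_on[OF bij_star]]) (auto intro: G'.src_closed)

lemma lift_eqI: "\<lbrakk>a \<in> Ar G'; src G' a = x; p1 a = b\<rbrakk> \<Longrightarrow> lift x b = a"
  using lift_p1 by blast

lemma lift_idt: "x' \<in> Ob G' \<Longrightarrow> p0 x' = x \<Longrightarrow> lift x' (idt G x) = idt G' x'"
  by (rule lift_eqI) (simp_all add: homD(5) G'.idt_closed G'.src_idt)

lemma lift_cmp:
  assumes "x \<in> Ob G'" "a \<in> Ar G" "b \<in> Ar G" "src G a = p0 x" "tgt G a = src G b"
  shows "lift x (cmp G a b) = cmp G' (lift x a) (lift (tgt G' (lift x a)) b)"
proof -
  note a = lift[OF assms(1,2,4)]
  have t: "tgt G' (lift x a) \<in> Ob G'" using a by (simp add: G'.gsimps)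
  note b = lift[OF t assms(3)]
  show ?thesis by (rule lift_eqI) (use a b assms in \<open>simp_all add: homD(6) G'.gsimps\<close>)
qed

lemma lift_ginv:
  assumes "x \<in> Ob G'" "a \<in> Ar G" "src G a = p0 x"
  shows "lift (tgt G' (lift x a)) (ginv G a) = ginv G' (lift x a)"
  by (rule lift_eqI) (use lift[OF assms] in \<open>simp_all add: G'.gsimps p1_ginv\<close>)

definition fibre :: "'o \<Rightarrow> 'p set" where
  "fibre x = {x' \<in> Ob G'. p0 x' = x}"

lemma fibreD: "x' \<in> fibre x \<Longrightarrow> x' \<in> Ob G'" "x' \<in> fibre x \<Longrightarrow> p0 x' = x"
  by (auto simp: fibre_def)

lemma lift_fibre:
  assumes "a \<in> Ar G" "x' \<in> fibre (src G a)"
  shows "lift x' a \<in> Ar G'" "src G' (lift x' a) = x'" "p1 (lift x' a) = a"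
    "tgt G' (lift x' a) \<in> fibre (tgt G a)"
  using lift[of x' a] assms by (auto simp: fibre_def G'.gsimps)

text \<open>Transitions between the fibres of \<open>p0\<close> along the lifts of \<open>a\<close> make this the right adjoint of
  pulling back along the covering: a homomorphism \<open>G' \<rightarrow> H\<close> over \<open>f0\<close> is the same as a section of
  the projection to \<open>G\<close>.\<close>

definition coinduced_groupoid ::
  "('q, 'v) groupoid \<Rightarrow> ('p \<Rightarrow> 'q) \<Rightarrow> ('o, 'a \<times> ('p \<Rightarrow> 'v)) groupoid" where
  "coinduced_groupoid H f0 =
     \<lparr>Ob = Ob G,
      Ar = {(a, h). a \<in> Ar G \<and> h \<in> (\<Pi>\<^sub>E x' \<in> fibre (src G a).
                     {k \<in> Ar H. src H k = f0 x' \<and> tgt H k = f0 (tgt G' (lift x' a))})},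
      src = (\<lambda>u. src G (fst u)), tgt = (\<lambda>u. tgt G (fst u)),
      cmp = (\<lambda>u v. (cmp G (fst u) (fst v),
               \<lambda>x' \<in> fibre (src G (fst u)). cmp H (snd u x') (snd v (tgt G' (lift x' (fst u)))))),
      idt = (\<lambda>x. (idt G x, \<lambda>x' \<in> fibre x. idt H (f0 x')))\<rparr>"

lemma groupoid_coinduced:
  assumes "groupoid H" and f0: "f0 \<in> Ob G' \<rightarrow> Ob H"
  shows "groupoid (coinduced_groupoid H f0)" (is "groupoid ?C")
proof -
  interpret H: groupoid H by fact
  have f0': "x' \<in> fibre x \<Longrightarrow> f0 x' \<in> Ob H" for x x' using f0 by (auto simp: fibre_def)
  have Ar: "u \<in> Ar ?C \<longleftrightarrow> fst u \<in> Ar G \<and> snd u \<in> extensional (fibre (src G (fst u))) \<and>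
      (\<forall>x' \<in> fibre (src G (fst u)). snd u x' \<in> Ar H \<and> src H (snd u x') = f0 x' \<and>
         tgt H (snd u x') = f0 (tgt G' (lift x' (fst u))))" for u
    by (cases u) (auto simp: coinduced_groupoid_def PiE_iff)
  have sel: "Ob ?C = Ob G" "src ?C u = src G (fst u)" "tgt ?C u = tgt G (fst u)"
    "cmp ?C u v = (cmp G (fst u) (fst v),
               \<lambda>x' \<in> fibre (src G (fst u)). cmp H (snd u x') (snd v (tgt G' (lift x' (fst u)))))"
    "idt ?C x = (idt G x, \<lambda>x' \<in> fibre x. idt H (f0 x'))" for u v x
    by (simp_all add: coinduced_groupoid_def)
  \<comment> \<open>A composite is lifted in stages, so the endpoint prescribed for a component of a
    composite is the one reached through the intermediate fibre.\<close>
  have cmpl: "tgt G' (lift x' (cmp G a b)) = tgt G' (lift (tgt G' (lift x' a)) b)"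
    if "x' \<in> fibre (src G a)" "a \<in> Ar G" "b \<in> Ar G" "tgt G a = src G b" for x' a b
    using that lift_cmp[of x' a b] lift_fibre[of a x'] lift_fibre[of b "tgt G' (lift x' a)"]
    by (simp add: fibreD G'.gsimps)
  have inAr: "fst u \<in> Ar G" "snd u \<in> extensional (fibre (src G (fst u)))" if "u \<in> Ar ?C" for u
    using that by (simp_all add: Ar)
  have val: "snd u x' \<in> Ar H" "src H (snd u x') = f0 x'" "tgt H (snd u x') = f0 (tgt G' (lift x' (fst u)))"
    if "u \<in> Ar ?C" "x' \<in> fibre (src G (fst u))" for u x'
    using that by (simp_all add: Ar)
  have mid: "tgt G' (lift x' (fst u)) \<in> fibre y"
    if "u \<in> Ar ?C" "x' \<in> fibre (src G (fst u))" "tgt G (fst u) = y" for u x' y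
    using lift_fibre(4)[OF inAr(1)] that by blast
  have prod_ext: "u = v" if "fst u = fst v" "snd u \<in> extensional (fibre z)" "snd v \<in> extensional (fibre z)"
    "\<And>x'. x' \<in> fibre z \<Longrightarrow> snd u x' = snd v x'" for z and u v :: "'a \<times> ('p \<Rightarrow> 'v)"
    using that by (intro prod_eqI extensionalityI[of _ "fibre z"])
  show ?thesis
  proof
    fix u assume u: "u \<in> Ar ?C"
    let ?a = "fst u"
    \<comment> \<open>The component of the inverse at \<open>y'\<close> inverts the component of
      \<open>u\<close> at the point where the lift of \<open>ginv G ?a\<close> from
      \<open>y'\<close> ends.\<close>
    let ?v = "(ginv G ?a, \<lambda>y' \<in> fibre (tgt G ?a). ginv H (snd u (tgt G' (lift y' (ginv G ?a)))))"
    have a: "?a \<in> Ar G" using u by (simp add: Ar)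
    have 1: "tgt G' (lift y' (ginv G ?a)) \<in> fibre (src G ?a)"
      "tgt G' (lift (tgt G' (lift y' (ginv G ?a))) ?a) = y'" if "y' \<in> fibre (tgt G ?a)" for y'
      using that a lift_fibre[of "ginv G ?a" y'] lift_ginv[of y' "ginv G ?a"]
      by (simp_all add: G.gsimps fibreD G.ginv_ginv G'.gsimps)
    have 2: "tgt G' (lift (tgt G' (lift x' ?a)) (ginv G ?a)) = x'" if "x' \<in> fibre (src G ?a)" for x'
      using that a lift_fibre[of ?a x'] lift_ginv[of x' ?a] by (simp add: fibreD G'.gsimps)
    have "?v \<in> Ar ?C"
      unfolding Ar using a 1 by (simp add: G.gsimps H.gsimps val[OF u])
    moreover have "cmp ?C u ?v = idt ?C (src ?C u)"
      by (rule prod_ext[of _ _ "src G ?a"])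
        (use a in \<open>simp_all add: sel G.gsimps H.gsimps val[OF u] lift_fibre 2\<close>)
    moreover have "cmp ?C ?v u = idt ?C (tgt ?C u)"
      by (rule prod_ext[of _ _ "tgt G ?a"])
        (use a in \<open>simp_all add: sel G.gsimps H.gsimps val[OF u] 1\<close>)
    ultimately show "\<exists>v. is_ginv ?C u v"
      using a by (intro exI[of _ ?v]) (simp add: is_ginv_def sel G.gsimps)
  next
    fix u v w assume "u \<in> Ar ?C" "v \<in> Ar ?C" "w \<in> Ar ?C" "tgt ?C u = src ?C v" "tgt ?C v = src ?C w"
    note uvw = this(1-3) this(4,5)[unfolded sel]
    show "cmp ?C (cmp ?C u v) w = cmp ?C u (cmp ?C v w)"
      by (rule prod_ext[of _ _ "src G (fst u)"])
        (use uvw in \<open>simp_all add: sel inAr val G.cmp_assoc G.gsimps H.cmp_assoc mid cmpl\<close>)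
  next
    fix u assume u: "u \<in> Ar ?C"
    show "cmp ?C (idt ?C (src ?C u)) u = u"
      by (rule prod_ext[of _ _ "src G (fst u)"])
        (use u in \<open>simp_all add: sel inAr val G.gsimps H.idt_left' lift_idt fibreD G'.gsimps\<close>)
    show "cmp ?C u (idt ?C (tgt ?C u)) = u"
      by (rule prod_ext[of _ _ "src G (fst u)"])
        (use u in \<open>simp_all add: sel inAr val G.gsimps H.idt_right' lift_fibre\<close>)
  next
    fix u v assume "u \<in> Ar ?C" "v \<in> Ar ?C" "tgt ?C u = src ?C v"
    note uv = this(1,2) this(3)[unfolded sel]
    show "cmp ?C u v \<in> Ar ?C"
      unfolding Ar[of "cmp ?C u v"]
      using uv lift_fibre(4)[of "fst u"] by (simp add: sel inAr val G.gsimps H.gsimps cmpl)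
  next
    fix x assume "x \<in> Ob ?C"
    then show "idt ?C x \<in> Ar ?C"
      by (simp add: Ar sel G.gsimps H.gsimps f0' lift_idt fibreD G'.gsimps)
  qed (simp_all add: sel inAr G.gsimps)
qed

text \<open>An arrow of \<open>G'\<close> is determined by its source and its image in
  \<open>G\<close>. So an extension is found by evaluating, at the source, the family that freeness
  over \<open>G\<close> assigns to the image, and uniqueness is tested over \<open>G\<close> on all
  lifts of an arrow at once.\<close>

lemma free_groupoid_covering:
  assumes free: "free_groupoid_on TYPE(('o, 'a, 'm) word_universe) G X"
  shows "free_groupoid_on TYPE('u) G' {a \<in> Ar G'. p1 a \<in> X}"
  unfolding free_groupoid_on_def
proof (intro conjI allI impI; (elim conjE)?)
  let ?X = "{a \<in> Ar G'. p1 a \<in> X}"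
  fix H :: "('u, 'u) groupoid" and f0 f
  assume "groupoid H" and f0: "f0 \<in> Ob G' \<rightarrow> Ob H" and f: "f \<in> ?X \<rightarrow> Ar H"
    and ends: "\<forall>a\<in>?X. src H (f a) = f0 (src G' a) \<and> tgt H (f a) = f0 (tgt G' a)"
  interpret H: groupoid H by fact
  have X: "a \<in> X \<Longrightarrow> a \<in> Ar G" for a using free by (auto simp: free_groupoid_on_def)
  let ?C = "coinduced_groupoid H f0"
  \<comment> \<open>The lifts of a basis arrow are exactly the basis arrows above it, so
    \<open>f\<close> assigns a whole family to it.\<close>
  define c where "c = (\<lambda>a. (a, \<lambda>x' \<in> fibre (src G a). f (lift x' a)))"
  have C: "groupoid ?C" by (rule groupoid_coinduced) fact+
  have "c \<in> X \<rightarrow> Ar ?C"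
    using f ends X lift_fibre by (auto simp: c_def coinduced_groupoid_def Pi_iff)
  then obtain F where F: "groupoid_hom G ?C (\<lambda>x. x) F" and Fc: "\<And>a. a \<in> X \<Longrightarrow> F a = c a"
    using free_groupoid_extend[OF free C, of "\<lambda>x. x" c]
    by (auto simp: c_def coinduced_groupoid_def)
  note FD = groupoid_homD[OF F]
  \<comment> \<open>The first component of \<open>F\<close> is an endomorphism of \<open>G\<close>
    fixing the basis, hence the identity. Thus the second component of \<open>F a\<close> is a
    family indexed by the lifts of \<open>a\<close> itself.\<close>
  have "groupoid_hom G G (\<lambda>x. x) (\<lambda>a. fst (F a))"
    unfolding groupoid_hom_def
    using FD(2) FD(3) FD(4) FD(5) FD(6) by (fastforce simp: coinduced_groupoid_def)
  then have fstF: "fst (F a) = a" if "a \<in> Ar G" for a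
    by (rule free_groupoid_hom_unique[OF free G.groupoid_axioms _ G.groupoid_hom_id _ that])
      (simp_all add: Fc c_def)
  have sndF: "snd (F a) x' \<in> Ar H" "src H (snd (F a) x') = f0 x'"
    "tgt H (snd (F a) x') = f0 (tgt G' (lift x' a))" if "a \<in> Ar G" "x' \<in> fibre (src G a)" for a x'
    using FD(2)[OF that(1)] fstF[OF that(1)] that(2) by (auto simp: coinduced_groupoid_def)
  define F' where "F' = (\<lambda>a. snd (F (p1 a)) (src G' a))"
  have fib: "src G' a \<in> fibre (src G (p1 a))" if "a \<in> Ar G'" for a
    using that by (simp add: fibre_def homD G'.gsimps)
  have F': "groupoid_hom G' H f0 F'"
    unfolding groupoid_hom_def
  proof (intro conjI ballI impI)
    show "F' (idt G' x) = idt H (f0 x)" if "x \<in> Ob G'" for x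
      using that FD(5)[of "p0 x"] by (simp add: F'_def homD G'.gsimps coinduced_groupoid_def fibre_def)
    show "F' (cmp G' a b) = cmp H (F' a) (F' b)" if "a \<in> Ar G'" "b \<in> Ar G'" "tgt G' a = src G' b" for a b
      using that FD(6)[of "p1 a" "p1 b"] fib[of a]
      by (simp add: F'_def homD G'.gsimps coinduced_groupoid_def fstF lift_p1)
  qed (use f0 sndF[OF homD(2) fib] in \<open>auto simp: F'_def lift_p1\<close>)
  moreover have "F' a = f a" if "a \<in> ?X" for a
    using that fib[of a] by (simp add: F'_def Fc c_def lift_p1)
  moreover have "F'' a = F' a" if F'': "groupoid_hom G' H f0 F''" "\<forall>a\<in>?X. F'' a = f a" "a \<in> Ar G'" for F'' a
  proof -
    note D = groupoid_homD[OF F'] groupoid_hom_ginv[OF G'.groupoid_axioms H.groupoid_axioms F']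
      groupoid_homD[OF F''(1)] groupoid_hom_ginv[OF G'.groupoid_axioms H.groupoid_axioms F''(1)]
    \<comment> \<open>Quantifying over all lifts makes agreement a property of arrows of
      \<open>G\<close>, where generation by \<open>X\<close> is available. The case of inverses uses
      that a lift of an inverse is the inverse of a lift from another point.\<close>
    let ?D = "{b \<in> Ar G. \<forall>x'\<in>fibre (src G b). F'' (lift x' b) = F' (lift x' b)}"
    have "wide_subgroupoid G ?D"
      unfolding wide_subgroupoid_def
    proof (intro conjI ballI impI)
      show "idt G x \<in> ?D" if "x \<in> Ob G" for x
        using that by (auto simp: G.gsimps lift_idt fibreD D)
      show "cmp G a b \<in> ?D" if "a \<in> ?D" "b \<in> ?D" "tgt G a = src G b" for a b
        using that lift_fibre[of a] lift_fibre[of b]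
        by (auto simp: G.gsimps lift_cmp fibreD D G'.src_closed)
      show "ginv G a \<in> ?D" if a: "a \<in> ?D" for a
      proof -
        have "F'' (lift y' (ginv G a)) = F' (lift y' (ginv G a))" if y: "y' \<in> fibre (tgt G a)" for y'
        proof -
          let ?x = "tgt G' (lift y' (ginv G a))"
          have x: "?x \<in> fibre (src G a)" "lift ?x a = ginv G' (lift y' (ginv G a))" "lift y' (ginv G a) \<in> Ar G'"
            using a y lift_fibre[of "ginv G a" y'] lift_ginv[of y' "ginv G a"]
            by (auto simp: G.gsimps G.ginv_ginv fibreD)
          then have "lift y' (ginv G a) = ginv G' (lift ?x a)" by (simp add: G'.ginv_ginv)
          moreover have "F'' (lift ?x a) = F' (lift ?x a)" "lift ?x a \<in> Ar G'"
            using a x(1) by (auto simp: lift_fibre)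
          then have "F'' (ginv G' (lift ?x a)) = F' (ginv G' (lift ?x a))"
            by (simp only: D)
          ultimately show ?thesis by simp
        qed
        then show ?thesis using a by (auto simp: G.gsimps)
      qed
    qed auto
    moreover have "X \<subseteq> ?D"
      using X that(2) \<open>\<And>a. a \<in> ?X \<Longrightarrow> F' a = f a\<close> by (auto simp: lift_fibre)
    ultimately have "?D = Ar G"
      by (intro free_groupoid_generated[OF free, of "\<lambda>x. {[Inl x]}" "\<lambda>a. {[Inr (Inl a)]}"])
        (auto simp: inj_def)
    then have "p1 a \<in> ?D" using that(3) homD(2) by auto
    then show ?thesis using fib[OF that(3)] lift_p1[OF that(3)] by auto
  qed
  ultimately show "\<exists>F. groupoid_hom G' H f0 F \<and> (\<forall>a\<in>?X. F a = f a) \<and>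
      (\<forall>F'. groupoid_hom G' H f0 F' \<and> (\<forall>a\<in>?X. F' a = f a) \<longrightarrow> (\<forall>a\<in>Ar G'. F' a = F a))"
    by (intro exI[of _ F']) blast
qed (auto simp: G'.groupoid_axioms)

end

section \<open>Crossed modules and their freeness\<close>

context groupoid_action
begin

lemma act_closed:
  "\<lbrakk>u \<in> Ar G; m \<in> carrier (grp M (src G u))\<rbrakk> \<Longrightarrow> act M m u \<in> carrier (grp M (tgt G u))"
  using act_hom[of u] by (auto simp: hom_def)

lemma act_mult:
  "\<lbrakk>u \<in> Ar G; m \<in> carrier (grp M (src G u)); n \<in> carrier (grp M (src G u))\<rbrakk>
    \<Longrightarrow> act M (m \<otimes>\<^bsub>grp M (src G u)\<^esub> n) u = act M m u \<otimes>\<^bsub>grp M (tgt G u)\<^esub> act M n u"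
  using act_hom[of u] by (auto simp: hom_def)

lemma act_group_hom:
  "u \<in> Ar G \<Longrightarrow> group_hom (grp M (src G u)) (grp M (tgt G u)) (\<lambda>m. act M m u)"
  using act_hom by (intro group_hom.intro group_hom_axioms.intro grp_group src_closed tgt_closed)

lemma act_one: "u \<in> Ar G \<Longrightarrow> act M \<one>\<^bsub>grp M (src G u)\<^esub> u = \<one>\<^bsub>grp M (tgt G u)\<^esub>"
  using group_hom.hom_one[OF act_group_hom] .

lemma act_inv: "\<lbrakk>u \<in> Ar G; m \<in> carrier (grp M (src G u))\<rbrakk>
    \<Longrightarrow> act M (inv\<^bsub>grp M (src G u)\<^esub> m) u = inv\<^bsub>grp M (tgt G u)\<^esub> (act M m u)"
  using group_hom.hom_inv[OF act_group_hom] .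

lemma monoid_grp: "x \<in> Ob G \<Longrightarrow> Group.monoid (grp M x)"
  using grp_group by (rule group.is_monoid)

lemmas grp_simps = monoid.one_closed[OF monoid_grp] monoid.m_closed[OF monoid_grp]
  group.inv_closed[OF grp_group] monoid.m_assoc[OF monoid_grp] monoid.l_one[OF monoid_grp]
  monoid.r_one[OF monoid_grp] group.l_inv[OF grp_group] group.r_inv[OF grp_group]

end

context crossed_module
begin

lemma bdry_closed:
  assumes "x \<in> Ob G" "m \<in> carrier (grp M x)"
  shows "\<mu> x m \<in> Ar G" "src G (\<mu> x m) = x" "tgt G (\<mu> x m) = x"
  using bdry_hom[OF assms(1)] assms(2) by (auto simp: hom_def vertex_group_def)

lemma bdry_mult:
  "\<lbrakk>x \<in> Ob G; m \<in> carrier (grp M x); n \<in> carrier (grp M x)\<rbrakk>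
    \<Longrightarrow> \<mu> x (m \<otimes>\<^bsub>grp M x\<^esub> n) = cmp G (\<mu> x m) (\<mu> x n)"
  using bdry_hom[of x] by (auto simp: hom_def vertex_group_def)

lemma bdry_group_hom: "x \<in> Ob G \<Longrightarrow> group_hom (grp M x) (vertex_group G x) (\<mu> x)"
  using bdry_hom by (intro group_hom.intro group_hom_axioms.intro grp_group vertex_group_group)

lemma bdry_one: "x \<in> Ob G \<Longrightarrow> \<mu> x \<one>\<^bsub>grp M x\<^esub> = idt G x"
  using group_hom.hom_one[OF bdry_group_hom] by (simp add: vertex_group_def)

lemma bdry_inv:
  assumes "x \<in> Ob G" "m \<in> carrier (grp M x)"
  shows "\<mu> x (inv\<^bsub>grp M x\<^esub> m) = ginv G (\<mu> x m)"
  using group_hom.hom_inv[OF bdry_group_hom] vertex_group_inv[of "\<mu> x m" x] assms bdry_hom[of x]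
  by (auto simp: hom_def)

end

lemma crossed_module_homD:
  assumes "crossed_module_hom G M \<mu> N \<nu> f" and "x \<in> Ob G"
  shows "f x \<in> hom (grp M x) (grp N x)"
    "m \<in> carrier (grp M x) \<Longrightarrow> f x m \<in> carrier (grp N x)"
    "\<lbrakk>m \<in> carrier (grp M x); n \<in> carrier (grp M x)\<rbrakk> \<Longrightarrow> f x (m \<otimes>\<^bsub>grp M x\<^esub> n) = f x m \<otimes>\<^bsub>grp N x\<^esub> f x n"
    "m \<in> carrier (grp M x) \<Longrightarrow> \<nu> x (f x m) = \<mu> x m"
  using assms unfolding crossed_module_hom_def gfamily_hom_def by (auto simp: hom_def)

lemma crossed_module_hom_act:
  assumes "crossed_module_hom G M \<mu> N \<nu> f" "u \<in> Ar G" "m \<in> carrier (grp M (src G u))"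
  shows "f (tgt G u) (act M m u) = act N (f (src G u) m) u"
  using assms unfolding crossed_module_hom_def gfamily_hom_def by auto

lemma crossed_module_hom_one_inv:
  assumes f: "crossed_module_hom G M \<mu> N \<nu> f" and "groupoid_action G M" "groupoid_action G N" and x: "x \<in> Ob G"
  shows "f x \<one>\<^bsub>grp M x\<^esub> = \<one>\<^bsub>grp N x\<^esub>"
    "m \<in> carrier (grp M x) \<Longrightarrow> f x (inv\<^bsub>grp M x\<^esub> m) = inv\<^bsub>grp N x\<^esub> (f x m)"
proof -
  have "group_hom (grp M x) (grp N x) (f x)"
    using crossed_module_homD(1)[OF f x] groupoid_action.grp_group[OF assms(2) x]
      groupoid_action.grp_group[OF assms(3) x]
    by (intro group_hom.intro group_hom_axioms.intro)
  then show "f x \<one>\<^bsub>grp M x\<^esub> = \<one>\<^bsub>grp N x\<^esub>"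
    "m \<in> carrier (grp M x) \<Longrightarrow> f x (inv\<^bsub>grp M x\<^esub> m) = inv\<^bsub>grp N x\<^esub> (f x m)"
    by (auto intro: group_hom.hom_one group_hom.hom_inv)
qed

text \<open>A \<open>G\<close>-module is a crossed module with trivial boundary, the Peiffer rule then being
  commutativity. So for \<open>A = True\<close> these are the \<open>G\<close>-modules on which \<open>K\<close> acts trivially, and for
  \<open>A = False\<close> they are all crossed modules: both notions of freeness are treated at once.\<close>

definition restricted_crossed_module ::
  "bool \<Rightarrow> ('o \<Rightarrow> 'a set) \<Rightarrow> ('o, 'a) groupoid \<Rightarrow> ('o, 'a, 'm) gfamily \<Rightarrow> ('o \<Rightarrow> 'm \<Rightarrow> 'a) \<Rightarrow> bool" where
  "restricted_crossed_module A K G M \<mu> \<longleftrightarrow> crossed_module G M \<mu> \<and>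
     (A \<longrightarrow> (\<forall>x\<in>Ob G. \<forall>m\<in>carrier (grp M x). \<mu> x m = idt G x \<and> (\<forall>k\<in>K x. act M m k = m)))"

definition free_restricted_on ::
  "'u itself \<Rightarrow> bool \<Rightarrow> ('o \<Rightarrow> 'a set) \<Rightarrow> ('o, 'a) groupoid \<Rightarrow> ('o \<Rightarrow> 'm set) \<Rightarrow>
    ('o, 'a, 'm) gfamily \<Rightarrow> ('o \<Rightarrow> 'm \<Rightarrow> 'a) \<Rightarrow> bool" where
  "free_restricted_on U A K G S M \<mu> \<longleftrightarrow>
     restricted_crossed_module A K G M \<mu> \<and>
     (\<forall>x\<in>Ob G. S x \<subseteq> carrier (grp M x)) \<and>
     (\<forall>(N :: ('o, 'a, 'u) gfamily) \<nu> g.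
        restricted_crossed_module A K G N \<nu> \<and>
        (\<forall>x\<in>Ob G. \<forall>s\<in>S x. g x s \<in> carrier (grp N x) \<and> \<nu> x (g x s) = \<mu> x s) \<longrightarrow>
        (\<exists>F. crossed_module_hom G M \<mu> N \<nu> F \<and> (\<forall>x\<in>Ob G. \<forall>s\<in>S x. F x s = g x s) \<and>
           (\<forall>F'. crossed_module_hom G M \<mu> N \<nu> F' \<and> (\<forall>x\<in>Ob G. \<forall>s\<in>S x. F' x s = g x s) \<longrightarrow>
              (\<forall>x\<in>Ob G. \<forall>m\<in>carrier (grp M x). F' x m = F x m))))"

section \<open>Subfamilies, their copies in another type, and generation by a free basis\<close>

definition subfamily :: "('o, 'a) groupoid \<Rightarrow> ('o, 'a, 'm) gfamily \<Rightarrow> ('o \<Rightarrow> 'm set) \<Rightarrow> bool" where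
  "subfamily G M D \<longleftrightarrow>
     (\<forall>x\<in>Ob G. D x \<subseteq> carrier (grp M x) \<and> \<one>\<^bsub>grp M x\<^esub> \<in> D x \<and>
        (\<forall>m\<in>D x. \<forall>n\<in>D x. m \<otimes>\<^bsub>grp M x\<^esub> n \<in> D x) \<and> (\<forall>m\<in>D x. inv\<^bsub>grp M x\<^esub> m \<in> D x)) \<and>
     (\<forall>u\<in>Ar G. \<forall>m\<in>D (src G u). act M m u \<in> D (tgt G u))"

lemma subfamilyD:
  assumes "subfamily G M D"
  shows "\<lbrakk>x \<in> Ob G; m \<in> D x\<rbrakk> \<Longrightarrow> m \<in> carrier (grp M x)" "x \<in> Ob G \<Longrightarrow> \<one>\<^bsub>grp M x\<^esub> \<in> D x"
    "\<lbrakk>x \<in> Ob G; m \<in> D x; n \<in> D x\<rbrakk> \<Longrightarrow> m \<otimes>\<^bsub>grp M x\<^esub> n \<in> D x"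
    "\<lbrakk>x \<in> Ob G; m \<in> D x\<rbrakk> \<Longrightarrow> inv\<^bsub>grp M x\<^esub> m \<in> D x"
    "\<lbrakk>u \<in> Ar G; m \<in> D (src G u)\<rbrakk> \<Longrightarrow> act M m u \<in> D (tgt G u)"
  using assms unfolding subfamily_def by blast+

text \<open>The codes depend on the object, because a set of words is formed at a given object. As
  \<open>act\<close> takes no object argument, the code to be undone is the one at
  \<open>src G u\<close>.\<close>

definition transport_family :: "('o, 'a) groupoid \<Rightarrow> ('o, 'a, 'm) gfamily \<Rightarrow> ('o \<Rightarrow> 'm set) \<Rightarrow>
    ('o \<Rightarrow> 'm \<Rightarrow> 'w) \<Rightarrow> ('o, 'a, 'w) gfamily" where
  "transport_family G M D \<phi> =
     \<lparr>grp = (\<lambda>x. \<lparr>carrier = \<phi> x ` D x,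
        mult = (\<lambda>a b. \<phi> x (inv_into (D x) (\<phi> x) a \<otimes>\<^bsub>grp M x\<^esub> inv_into (D x) (\<phi> x) b)),
        one = \<phi> x \<one>\<^bsub>grp M x\<^esub>\<rparr>),
      act = (\<lambda>m u. \<phi> (tgt G u) (act M (inv_into (D (src G u)) (\<phi> (src G u)) m) u))\<rparr>"

locale transported_crossed_module = crossed_module G N \<nu>
  for G :: "('o, 'a) groupoid" and N :: "('o, 'a, 'v) gfamily" and \<nu> +
  fixes D :: "'o \<Rightarrow> 'v set" and \<phi> :: "'o \<Rightarrow> 'v \<Rightarrow> 'w"
  assumes sub: "subfamily G N D" and inj: "\<And>x. x \<in> Ob G \<Longrightarrow> inj_on (\<phi> x) (D x)"
begin

abbreviation (input) "\<psi> x \<equiv> inv_into (D x) (\<phi> x)"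

abbreviation (input) "T \<equiv> transport_family G N D \<phi>"

lemmas D = subfamilyD[OF sub]

lemma \<psi>: "\<lbrakk>x \<in> Ob G; m \<in> D x\<rbrakk> \<Longrightarrow> \<psi> x (\<phi> x m) = m"
  using inj by simp

lemma carrier_T: "carrier (grp T x) = \<phi> x ` D x"
  and mult_T: "\<lbrakk>x \<in> Ob G; m \<in> D x; n \<in> D x\<rbrakk> \<Longrightarrow> \<phi> x m \<otimes>\<^bsub>grp T x\<^esub> \<phi> x n = \<phi> x (m \<otimes>\<^bsub>grp N x\<^esub> n)"
  and one_T: "\<one>\<^bsub>grp T x\<^esub> = \<phi> x \<one>\<^bsub>grp N x\<^esub>"
  and act_T: "\<lbrakk>x \<in> Ob G; m \<in> D x; src G u = x\<rbrakk> \<Longrightarrow> act T (\<phi> x m) u = \<phi> (tgt G u) (act N m u)"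
  by (auto simp: transport_family_def \<psi>)

lemma group_T:
  assumes x: "x \<in> Ob G"
  shows "group (grp T x)"
proof (rule groupI)
  fix a assume "a \<in> carrier (grp T x)"
  then obtain m where "m \<in> D x" "a = \<phi> x m" by (auto simp: carrier_T)
  then show "\<exists>b\<in>carrier (grp T x). b \<otimes>\<^bsub>grp T x\<^esub> a = \<one>\<^bsub>grp T x\<^esub>"
    using x by (intro bexI[of _ "\<phi> x (inv\<^bsub>grp N x\<^esub> m)"]) (simp_all add: carrier_T mult_T one_T D grp_simps)
qed (use x in \<open>auto simp: carrier_T mult_T one_T D grp_simps\<close>)

lemma inv_T:
  assumes x: "x \<in> Ob G" and m: "m \<in> D x"
  shows "inv\<^bsub>grp T x\<^esub> (\<phi> x m) = \<phi> x (inv\<^bsub>grp N x\<^esub> m)"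
  by (rule group.inv_equality[OF group_T])
    (use assms in \<open>simp_all add: carrier_T mult_T one_T D grp_simps\<close>)

lemma crossed_module_T: "crossed_module G T (\<lambda>x m. \<nu> x (\<psi> x m))"
proof (intro crossed_module.intro crossed_module_axioms.intro groupoid_action.intro
    groupoid_action_axioms.intro groupoid_axioms)
  fix u assume u: "u \<in> Ar G"
  show "(\<lambda>m. act T m u) \<in> hom (grp T (src G u)) (grp T (tgt G u))"
    using u by (auto simp: hom_def carrier_T mult_T act_T D gsimps act_mult)
  fix m assume "m \<in> carrier (grp T (src G u))"
  then show "\<nu> (tgt G u) (\<psi> (tgt G u) (act T m u)) = cmp G (cmp G (ginv G u) (\<nu> (src G u) (\<psi> (src G u) m))) u"
    using u bdry_act by (auto simp: carrier_T act_T D gsimps \<psi>)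
next
  fix u v m assume "u \<in> Ar G" "v \<in> Ar G" "tgt G u = src G v" "m \<in> carrier (grp T (src G u))"
  moreover from this obtain n where "n \<in> D (src G u)" "m = \<phi> (src G u) n" by (auto simp: carrier_T)
  moreover have "act N n u \<in> D (src G v)" using D(5)[of u n] calculation by simp
  ultimately show "act T m (cmp G u v) = act T (act T m u) v"
    by (simp add: act_T gsimps act_cmp D(1))
next
  fix x m n assume "x \<in> Ob G" "m \<in> carrier (grp T x)" "n \<in> carrier (grp T x)"
  then show "inv\<^bsub>grp T x\<^esub> n \<otimes>\<^bsub>grp T x\<^esub> m \<otimes>\<^bsub>grp T x\<^esub> n = act T m (\<nu> x (\<psi> x n))"
    by (auto simp: carrier_T inv_T mult_T act_T D \<psi> bdry_closed peiffer)
next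
  fix x assume "x \<in> Ob G"
  then show "(\<lambda>m. \<nu> x (\<psi> x m)) \<in> hom (grp T x) (vertex_group G x)"
    by (auto simp: hom_def vertex_group_def carrier_T mult_T D \<psi> bdry_closed bdry_mult)
  fix m assume "m \<in> carrier (grp T x)"
  then show "act T m (idt G x) = m"
    using \<open>x \<in> Ob G\<close> by (auto simp: carrier_T act_T gsimps act_idt D(1))
qed (simp_all add: group_T)

end

text \<open>The counterpart for families of the transport of a universal property along a coded
  subgroupoid: uniqueness again concerns only morphisms with values in \<open>D\<close>.\<close>

lemma free_restricted_transport:
  fixes G :: "('o, 'a) groupoid" and N :: "('o, 'a, 'v) gfamily" and \<phi> :: "'o \<Rightarrow> 'v \<Rightarrow> 'w"
  assumes free: "free_restricted_on TYPE('w) A K G S M \<mu>" and KG: "\<And>x. x \<in> Ob G \<Longrightarrow> K x \<subseteq> carrier (vertex_group G x)"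
    and N: "restricted_crossed_module A K G N \<nu>"
    and sub: "subfamily G N D" and inj: "\<And>x. x \<in> Ob G \<Longrightarrow> inj_on (\<phi> x) (D x)"
    and g: "\<And>x s. \<lbrakk>x \<in> Ob G; s \<in> S x\<rbrakk> \<Longrightarrow> g x s \<in> D x \<and> \<nu> x (g x s) = \<mu> x s"
  shows "\<exists>F. crossed_module_hom G M \<mu> N \<nu> F \<and> (\<forall>x\<in>Ob G. F x \<in> carrier (grp M x) \<rightarrow> D x) \<and>
    (\<forall>x\<in>Ob G. \<forall>s\<in>S x. F x s = g x s) \<and>
    (\<forall>F'. crossed_module_hom G M \<mu> N \<nu> F' \<and> (\<forall>x\<in>Ob G. F' x \<in> carrier (grp M x) \<rightarrow> D x) \<and>
       (\<forall>x\<in>Ob G. \<forall>s\<in>S x. F' x s = g x s) \<longrightarrow> (\<forall>x\<in>Ob G. \<forall>m\<in>carrier (grp M x). F' x m = F x m))"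
proof -
  interpret N: crossed_module G N \<nu> using N by (simp add: restricted_crossed_module_def)
  interpret M: crossed_module G M \<mu>
    using free by (simp add: free_restricted_on_def restricted_crossed_module_def)
  interpret transported_crossed_module G N \<nu> D \<phi> by unfold_locales (use sub inj in auto)
  have SM: "\<lbrakk>x \<in> Ob G; s \<in> S x\<rbrakk> \<Longrightarrow> s \<in> carrier (grp M x)" for x s
    using free by (auto simp: free_restricted_on_def)
  \<comment> \<open>Triviality of the action passes to the copy because \<open>K x\<close> consists
    of loops: elements are decoded and coded again at the same object \<open>x\<close>.\<close>
  have "restricted_crossed_module A K G T (\<lambda>x m. \<nu> x (\<psi> x m))"
    using N KG crossed_module_T
    by (fastforce simp: restricted_crossed_module_def vertex_group_def carrier_T act_T D \<psi>)
  moreover have "\<forall>x\<in>Ob G. \<forall>s\<in>S x. \<phi> x (g x s) \<in> carrier (grp T x) \<and> \<nu> x (\<psi> x (\<phi> x (g x s))) = \<mu> x s"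
    using g by (simp add: carrier_T \<psi>)
  ultimately have "\<exists>F. crossed_module_hom G M \<mu> T (\<lambda>x m. \<nu> x (\<psi> x m)) F \<and>
      (\<forall>x\<in>Ob G. \<forall>s\<in>S x. F x s = \<phi> x (g x s)) \<and>
      (\<forall>F'. crossed_module_hom G M \<mu> T (\<lambda>x m. \<nu> x (\<psi> x m)) F' \<and>
         (\<forall>x\<in>Ob G. \<forall>s\<in>S x. F' x s = \<phi> x (g x s)) \<longrightarrow> (\<forall>x\<in>Ob G. \<forall>m\<in>carrier (grp M x). F' x m = F x m))"
    using free[unfolded free_restricted_on_def, THEN conjunct2, THEN conjunct2, rule_format,
        of T "\<lambda>x m. \<nu> x (\<psi> x m)" "\<lambda>x s. \<phi> x (g x s)"] by blast
  then obtain F where F: "crossed_module_hom G M \<mu> T (\<lambda>x m. \<nu> x (\<psi> x m)) F"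
    "\<And>x s. \<lbrakk>x \<in> Ob G; s \<in> S x\<rbrakk> \<Longrightarrow> F x s = \<phi> x (g x s)"
    and uniq: "\<And>F' x m. \<lbrakk>crossed_module_hom G M \<mu> T (\<lambda>x m. \<nu> x (\<psi> x m)) F';
      \<forall>x\<in>Ob G. \<forall>s\<in>S x. F' x s = \<phi> x (g x s); x \<in> Ob G; m \<in> carrier (grp M x)\<rbrakk> \<Longrightarrow> F' x m = F x m"
    by blast
  define F1 where "F1 = (\<lambda>x m. \<psi> x (F x m))"
  note FD = crossed_module_homD[OF F(1)] crossed_module_hom_act[OF F(1)]
  have F1: "\<phi> x (F1 x m) = F x m" and F1D: "F1 x m \<in> D x" if "x \<in> Ob G" "m \<in> carrier (grp M x)" for x m
    using FD(2)[OF that] inv_into_into[of "F x m" "\<phi> x" "D x"] f_inv_into_f[of "F x m" "\<phi> x" "D x"]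
    by (simp_all add: F1_def carrier_T)
  have \<phi>: "m = n" if "\<phi> x m = \<phi> x n" "x \<in> Ob G" "m \<in> D x" "n \<in> D x" for x m n
    using inj that by (auto dest: inj_onD)
  have hom: "crossed_module_hom G M \<mu> N \<nu> F1"
    unfolding crossed_module_hom_def gfamily_hom_def hom_def
  proof (intro conjI ballI CollectI funcsetI)
    fix x m assume x: "x \<in> Ob G" and m: "m \<in> carrier (grp M x)"
    show "F1 x m \<in> carrier (grp N x)" "\<nu> x (F1 x m) = \<mu> x m"
      using x m F1D FD(4) by (auto simp: D(1) F1_def)
    fix n assume n: "n \<in> carrier (grp M x)"
    show "F1 x (m \<otimes>\<^bsub>grp M x\<^esub> n) = F1 x m \<otimes>\<^bsub>grp N x\<^esub> F1 x n"
    proof (rule \<phi>[OF _ x])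
      have "\<phi> x (F1 x (m \<otimes>\<^bsub>grp M x\<^esub> n)) = F x m \<otimes>\<^bsub>grp T x\<^esub> F x n"
        using x m n by (simp add: F1 FD(3) M.grp_simps)
      also have "\<dots> = \<phi> x (F1 x m \<otimes>\<^bsub>grp N x\<^esub> F1 x n)"
        using x m n by (simp add: mult_T F1D flip: F1)
      finally show "\<phi> x (F1 x (m \<otimes>\<^bsub>grp M x\<^esub> n)) = \<phi> x (F1 x m \<otimes>\<^bsub>grp N x\<^esub> F1 x n)" .
    qed (use x m n in \<open>simp_all add: F1D D M.grp_simps\<close>)
  next
    fix u m assume u: "u \<in> Ar G" and m: "m \<in> carrier (grp M (src G u))"
    show "F1 (tgt G u) (act M m u) = act N (F1 (src G u) m) u"
    proof (rule \<phi>[OF _ N.tgt_closed[OF u]])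
      have "\<phi> (tgt G u) (F1 (tgt G u) (act M m u)) = act T (F (src G u) m) u"
        using u m by (simp add: F1 FD(5) M.act_closed N.gsimps)
      also have "\<dots> = \<phi> (tgt G u) (act N (F1 (src G u) m) u)"
        using u m by (simp add: act_T F1D N.gsimps flip: F1)
      finally show "\<phi> (tgt G u) (F1 (tgt G u) (act M m u)) = \<phi> (tgt G u) (act N (F1 (src G u) m) u)" .
    qed (use u m in \<open>simp_all add: F1D D M.act_closed N.gsimps\<close>)
  qed
  have agree: "F1 x s = g x s" if "x \<in> Ob G" "s \<in> S x" for x s
    using that F(2) g by (simp add: F1_def \<psi>)
  have unique: "F' x m = F1 x m" if F': "crossed_module_hom G M \<mu> N \<nu> F'"
    "\<forall>x\<in>Ob G. F' x \<in> carrier (grp M x) \<rightarrow> D x" "\<forall>x\<in>Ob G. \<forall>s\<in>S x. F' x s = g x s"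
    and x: "x \<in> Ob G" and m: "m \<in> carrier (grp M x)" for F' x m
  proof (rule \<phi>[OF _ x])
    have F'D: "\<lbrakk>x \<in> Ob G; m \<in> carrier (grp M x)\<rbrakk> \<Longrightarrow> F' x m \<in> D x" for x m using F'(2) by auto
    note D' = crossed_module_homD[OF F'(1)] crossed_module_hom_act[OF F'(1)]
    have "crossed_module_hom G M \<mu> T (\<lambda>x m. \<nu> x (\<psi> x m)) (\<lambda>x m. \<phi> x (F' x m))"
      unfolding crossed_module_hom_def gfamily_hom_def hom_def
      by (auto simp: carrier_T mult_T act_T F'D D' \<psi> N.gsimps)
    from uniq[OF this _ x m] show "\<phi> x (F' x m) = \<phi> x (F1 x m)"
      using F' x m by (simp add: F1)
  qed (use F' F1D x m in auto)
  show ?thesis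
    using hom F1D agree unique by (intro exI[of _ F1]) blast
qed

text \<open>Freeness extends the inclusion of the basis to a morphism with values in
  \<open>D\<close>. As an endomorphism of \<open>M\<close> fixing the basis it is the identity, so
  every element of \<open>M\<close> is one of its values.\<close>

lemma free_restricted_generated:
  fixes G :: "('o, 'a) groupoid" and M :: "('o, 'a, 'm) gfamily" and \<phi> :: "'m \<Rightarrow> 'w"
  assumes free: "free_restricted_on TYPE('w) A K G S M \<mu>" and KG: "\<And>x. x \<in> Ob G \<Longrightarrow> K x \<subseteq> carrier (vertex_group G x)"
    and inj: "inj \<phi>" and sub: "subfamily G M D" and S: "\<And>x. x \<in> Ob G \<Longrightarrow> S x \<subseteq> D x" and x: "x \<in> Ob G"
  shows "D x = carrier (grp M x)"
proof
  have M: "restricted_crossed_module A K G M \<mu>" using free by (simp add: free_restricted_on_def)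
  interpret M: crossed_module G M \<mu> using M by (simp add: restricted_crossed_module_def)
  show "D x \<subseteq> carrier (grp M x)" using subfamilyD(1)[OF sub x] by blast
  have i: "inj_on \<phi> B" for B using inj by (auto intro: inj_on_subset)
  let ?D = "\<lambda>x. carrier (grp M x)"
  have full: "subfamily G M ?D"
    by (auto simp: subfamily_def M.grp_simps M.act_closed)
  have S': "s \<in> D x \<and> \<mu> x s = \<mu> x s" "s \<in> ?D x \<and> \<mu> x s = \<mu> x s" if "x \<in> Ob G" "s \<in> S x" for x s
    using S[OF that(1)] that subfamilyD(1)[OF sub that(1)] by auto
  have idhom: "crossed_module_hom G M \<mu> M \<mu> (\<lambda>x m. m)"
    by (auto simp: crossed_module_hom_def gfamily_hom_def hom_def)
  obtain F where F: "crossed_module_hom G M \<mu> M \<mu> F" "\<forall>x\<in>Ob G. F x \<in> carrier (grp M x) \<rightarrow> D x"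
      "\<forall>x\<in>Ob G. \<forall>s\<in>S x. F x s = s"
    using free_restricted_transport[where \<phi>="\<lambda>_. \<phi>" and g="\<lambda>x s. s", OF free _ M sub] KG i S'(1) by auto
  obtain F0 where "\<forall>F'. crossed_module_hom G M \<mu> M \<mu> F' \<and> (\<forall>x\<in>Ob G. F' x \<in> carrier (grp M x) \<rightarrow> ?D x) \<and>
       (\<forall>x\<in>Ob G. \<forall>s\<in>S x. F' x s = s) \<longrightarrow> (\<forall>x\<in>Ob G. \<forall>m\<in>carrier (grp M x). F' x m = F0 x m)"
    using free_restricted_transport[where \<phi>="\<lambda>_. \<phi>" and g="\<lambda>x s. s", OF free _ M full] KG i S'(2) by auto
  then have F0: "\<lbrakk>crossed_module_hom G M \<mu> M \<mu> F'; \<forall>x\<in>Ob G. F' x \<in> carrier (grp M x) \<rightarrow> ?D x;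
       \<forall>x\<in>Ob G. \<forall>s\<in>S x. F' x s = s; m \<in> carrier (grp M x)\<rbrakk> \<Longrightarrow> F' x m = F0 x m" for F' m
    using x by blast
  show "carrier (grp M x) \<subseteq> D x"
  proof
    fix m assume m: "m \<in> carrier (grp M x)"
    have "\<forall>x\<in>Ob G. F x \<in> carrier (grp M x) \<rightarrow> ?D x" using crossed_module_homD(2)[OF F(1)] by blast
    from F0[OF F(1) this F(3) m] have "F x m = F0 x m" .
    also have "F0 x m = m" by (rule F0[OF idhom _ _ m, symmetric]) auto
    finally show "m \<in> D x" using F(2) x m by (metis PiE)
  qed
qed

text \<open>The letter \<open>s\<^sup>u\<close> is coded as \<open>u\<close> followed by \<open>s\<close>, its inverse as \<open>s\<close> followed by \<open>u\<close>.\<close>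

inductive family_word :: "('o, 'a) groupoid \<Rightarrow> ('o, 'a, 'v) gfamily \<Rightarrow> ('o \<Rightarrow> 's set) \<Rightarrow> ('o \<Rightarrow> 's \<Rightarrow> 'v) \<Rightarrow>
    'o \<Rightarrow> ('o + 'a + 's) list \<Rightarrow> 'v \<Rightarrow> bool"
  for G N S g x where
  base: "family_word G N S g x [Inl x] \<one>\<^bsub>grp N x\<^esub>"
| pos: "\<lbrakk>family_word G N S g x w n; u \<in> Ar G; tgt G u = x; s \<in> S (src G u)\<rbrakk>
    \<Longrightarrow> family_word G N S g x (Inr (Inl u) # Inr (Inr s) # w) (act N (g (src G u) s) u \<otimes>\<^bsub>grp N x\<^esub> n)"
| neg: "\<lbrakk>family_word G N S g x w n; u \<in> Ar G; tgt G u = x; s \<in> S (src G u)\<rbrakk>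
    \<Longrightarrow> family_word G N S g x (Inr (Inr s) # Inr (Inl u) # w)
          (inv\<^bsub>grp N x\<^esub> (act N (g (src G u) s) u) \<otimes>\<^bsub>grp N x\<^esub> n)"

text \<open>The first letter decides the rule, since the three rules start in different summands.
  The letter \<open>u\<close> also fixes the object \<open>src G u\<close> at which \<open>s\<close>
  is read, which matters because carriers may overlap.\<close>

lemma family_word_unique:
  "family_word G N S g x w n \<Longrightarrow> family_word G N S g x w n' \<Longrightarrow> n = n'"
proof (induction arbitrary: n' rule: family_word.induct)
  case base
  then show ?case by (auto elim: family_word.cases)
next
  case (pos w n u s)
  from pos.prems show ?case
    by (cases rule: family_word.cases) (use pos.IH in auto)
next
  case (neg w n u s)
  from neg.prems show ?case
    by (cases rule: family_word.cases) (use neg.IH in auto)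
qed

lemma family_words_subfamily:
  fixes G :: "('o, 'a) groupoid" and N :: "('o, 'a, 'v) gfamily"
  assumes "groupoid_action G N" and g: "\<And>x s. \<lbrakk>x \<in> Ob G; s \<in> S x\<rbrakk> \<Longrightarrow> g x s \<in> carrier (grp N x)"
  shows "subfamily G N (\<lambda>x. {n. \<exists>w. family_word G N S g x w n})"
    and "\<lbrakk>x \<in> Ob G; s \<in> S x\<rbrakk> \<Longrightarrow> \<exists>w. family_word G N S g x w (g x s)"
proof -
  interpret N: groupoid_action G N by fact
  let ?D = "\<lambda>x n. \<exists>w. family_word G N S g x w n"
  have gu: "act N (g (src G u) s) u \<in> carrier (grp N (tgt G u))" if "u \<in> Ar G" "s \<in> S (src G u)" for u s
    using that g by (simp add: N.act_closed N.gsimps)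
  have Car: "n \<in> carrier (grp N x)" if "family_word G N S g x w n" "x \<in> Ob G" for x w n
    using that by (induction rule: family_word.induct) (use gu in \<open>auto simp: N.grp_simps\<close>)
  have base: "?D x \<one>\<^bsub>grp N x\<^esub>" for x
    by (rule exI) (rule family_word.base)
  have pos: "?D x (act N (g (src G u) s) u \<otimes>\<^bsub>grp N x\<^esub> n)"
    and neg: "?D x (inv\<^bsub>grp N x\<^esub> (act N (g (src G u) s) u) \<otimes>\<^bsub>grp N x\<^esub> n)"
    if "?D x n" "u \<in> Ar G" "tgt G u = x" "s \<in> S (src G u)" for x n u s
    using that by (auto intro: family_word.pos family_word.neg)
  have mult: "?D x n \<Longrightarrow> ?D x (m \<otimes>\<^bsub>grp N x\<^esub> n)"
    if "family_word G N S g x w m" "x \<in> Ob G" for x w m n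
    using that
  proof (induction rule: family_word.induct)
    case base
    then show ?case using Car by (auto simp: N.grp_simps)
  next
    case (pos w m u s)
    then have "act N (g (src G u) s) u \<otimes>\<^bsub>grp N x\<^esub> m \<otimes>\<^bsub>grp N x\<^esub> n =
        act N (g (src G u) s) u \<otimes>\<^bsub>grp N x\<^esub> (m \<otimes>\<^bsub>grp N x\<^esub> n)"
      using Car gu[of u s] by (auto simp: N.grp_simps)
    then show ?case using pos by (metis that(2) family_word.pos)
  next
    case (neg w m u s)
    then have "inv\<^bsub>grp N x\<^esub> (act N (g (src G u) s) u) \<otimes>\<^bsub>grp N x\<^esub> m \<otimes>\<^bsub>grp N x\<^esub> n =
        inv\<^bsub>grp N x\<^esub> (act N (g (src G u) s) u) \<otimes>\<^bsub>grp N x\<^esub> (m \<otimes>\<^bsub>grp N x\<^esub> n)"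
      using Car gu[of u s] by (auto simp: N.grp_simps)
    then show ?case using neg by (metis that(2) family_word.neg)
  qed
  have gen: "?D (tgt G u) (act N (g (src G u) s) u)" "?D (tgt G u) (inv\<^bsub>grp N (tgt G u)\<^esub> (act N (g (src G u) s) u))"
    if "u \<in> Ar G" "s \<in> S (src G u)" for u s
    using pos[OF base that(1) refl that(2)] neg[OF base that(1) refl that(2)] gu[OF that] that
    by (simp_all add: N.grp_simps N.gsimps)
  \<comment> \<open>Words are made of translates of generators; a generator itself is its translate
    along the identity.\<close>
  show "?D x (g x s)" if "x \<in> Ob G" "s \<in> S x" for x s
    using gen(1)[of "idt G x" s] that g[OF that] by (simp add: N.gsimps N.act_idt)
  have inv: "?D x (inv\<^bsub>grp N x\<^esub> m)"
    if "family_word G N S g x w m" "x \<in> Ob G" for x w m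
    using that
  proof (induction rule: family_word.induct)
    case base
    then show ?case using \<open>\<And>x. ?D x \<one>\<^bsub>grp N x\<^esub>\<close> by (simp add: monoid.inv_one[OF N.monoid_grp])
  next
    case (pos w m u s)
    then have "inv\<^bsub>grp N x\<^esub> (act N (g (src G u) s) u \<otimes>\<^bsub>grp N x\<^esub> m) =
        inv\<^bsub>grp N x\<^esub> m \<otimes>\<^bsub>grp N x\<^esub> inv\<^bsub>grp N x\<^esub> (act N (g (src G u) s) u)"
      using Car gu[of u s] by (auto simp: group.inv_mult_group[OF N.grp_group])
    moreover obtain w' where "family_word G N S g x w' (inv\<^bsub>grp N x\<^esub> m)" using pos by blast
    ultimately show ?case using mult gen(2)[of u s] pos by simp
  next
    case (neg w m u s)
    then have "inv\<^bsub>grp N x\<^esub> (inv\<^bsub>grp N x\<^esub> (act N (g (src G u) s) u) \<otimes>\<^bsub>grp N x\<^esub> m) =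
        inv\<^bsub>grp N x\<^esub> m \<otimes>\<^bsub>grp N x\<^esub> act N (g (src G u) s) u"
      using Car gu[of u s]
      by (auto simp: group.inv_mult_group[OF N.grp_group] group.inv_inv[OF N.grp_group] N.grp_simps)
    moreover obtain w' where "family_word G N S g x w' (inv\<^bsub>grp N x\<^esub> m)" using neg by blast
    ultimately show ?case using mult gen(1)[of u s] neg by simp
  qed
  \<comment> \<open>Acting by \<open>v\<close> turns a letter for the translate along
    \<open>u\<close> into one for the translate along \<open>cmp G u v\<close>, so the word keeps
    its shape.\<close>
  have act: "?D (tgt G v) (act N m v)"
    if "family_word G N S g (src G v) w m" "v \<in> Ar G" for v w m
    using that
  proof (induction rule: family_word.induct)
    case base
    then show ?case using \<open>\<And>x. ?D x \<one>\<^bsub>grp N x\<^esub>\<close> by (simp add: N.act_one)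
  next
    case (pos w m u s)
    have "act N (act N (g (src G u) s) u \<otimes>\<^bsub>grp N (src G v)\<^esub> m) v =
        act N (g (src G (cmp G u v)) s) (cmp G u v) \<otimes>\<^bsub>grp N (tgt G v)\<^esub> act N m v"
      using pos Car gu[of u s] g by (auto simp: N.act_mult N.act_cmp N.gsimps)
    then show ?case using pos \<open>\<And>x n u s. \<lbrakk>?D x n; u \<in> Ar G; tgt G u = x; s \<in> S (src G u)\<rbrakk> \<Longrightarrow>
        ?D x (act N (g (src G u) s) u \<otimes>\<^bsub>grp N x\<^esub> n)\<close>[of "tgt G v" "act N m v" "cmp G u v" s]
      by (simp add: N.gsimps)
  next
    case (neg w m u s)
    have "act N (inv\<^bsub>grp N (src G v)\<^esub> (act N (g (src G u) s) u) \<otimes>\<^bsub>grp N (src G v)\<^esub> m) v =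
        inv\<^bsub>grp N (tgt G v)\<^esub> (act N (g (src G (cmp G u v)) s) (cmp G u v)) \<otimes>\<^bsub>grp N (tgt G v)\<^esub> act N m v"
      using neg Car gu[of u s] g by (auto simp: N.act_mult N.act_cmp N.act_inv N.gsimps N.grp_simps)
    then show ?case using neg \<open>\<And>x n u s. \<lbrakk>?D x n; u \<in> Ar G; tgt G u = x; s \<in> S (src G u)\<rbrakk> \<Longrightarrow>
        ?D x (inv\<^bsub>grp N x\<^esub> (act N (g (src G u) s) u) \<otimes>\<^bsub>grp N x\<^esub> n)\<close>[of "tgt G v" "act N m v" "cmp G u v" s]
      by (simp add: N.gsimps)
  qed
  show "subfamily G N (\<lambda>x. {n. ?D x n})"
    unfolding subfamily_def subset_eq Ball_def mem_Collect_eq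
    using Car base mult inv act by metis
qed

text \<open>A test family already lives over the objects and arrows of \<open>G\<close>, so only its
  elements are coded, at each object by their sets of words.\<close>

lemma free_restricted_extend:
  fixes G :: "('o, 'a) groupoid" and M :: "('o, 'a, 'm) gfamily" and N :: "('o, 'a, 'v) gfamily"
  assumes free: "free_restricted_on TYPE(('o, 'a, 'm) word_universe) A K G S M \<mu>"
    and KG: "\<And>x. x \<in> Ob G \<Longrightarrow> K x \<subseteq> carrier (vertex_group G x)"
    and N: "restricted_crossed_module A K G N \<nu>"
    and g: "\<And>x s. \<lbrakk>x \<in> Ob G; s \<in> S x\<rbrakk> \<Longrightarrow> g x s \<in> carrier (grp N x) \<and> \<nu> x (g x s) = \<mu> x s"
  obtains F where "crossed_module_hom G M \<mu> N \<nu> F" "\<And>x s. \<lbrakk>x \<in> Ob G; s \<in> S x\<rbrakk> \<Longrightarrow> F x s = g x s"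
proof -
  interpret N: crossed_module G N \<nu> using N by (simp add: restricted_crossed_module_def)
  let ?D = "\<lambda>x. {n. \<exists>w. family_word G N S g x w n}"
  have g': "\<lbrakk>x \<in> Ob G; s \<in> S x\<rbrakk> \<Longrightarrow> g x s \<in> carrier (grp N x)" for x s using g by blast
  have words: "subfamily G N ?D" "\<lbrakk>x \<in> Ob G; s \<in> S x\<rbrakk> \<Longrightarrow> g x s \<in> ?D x" for x s
    using family_words_subfamily[OF N.groupoid_action_axioms, of S g] g' by auto
  have inj: "inj_on (\<lambda>n. {w. family_word G N S g x w n}) (?D x)" for x
    by (rule inj_on_codes) (rule family_word_unique)
  have g'': "g x s \<in> ?D x \<and> \<nu> x (g x s) = \<mu> x s" if "x \<in> Ob G" "s \<in> S x" for x s
    using words(2)[OF that] g[OF that] by blast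
  show ?thesis
    using free_restricted_transport[OF free KG N words(1) inj g''] that by blast
qed

section \<open>Coinduced families, and freeness of the pulled back crossed module or module\<close>

context groupoid_cover
begin

text \<open>The lift of \<open>u\<close> that ends at \<open>y\<close> instead of starting there. A
  right action carries elements to the target of an arrow, so the component of a translate at a
  point of the fibre comes along the lift ending at that point.\<close>

definition colift :: "'p \<Rightarrow> 'a \<Rightarrow> 'b" where
  "colift y u = ginv G' (lift y (ginv G u))"

lemma colift:
  assumes "u \<in> Ar G" "y' \<in> fibre (tgt G u)"
  shows "colift y' u \<in> Ar G'" "tgt G' (colift y' u) = y'" "p1 (colift y' u) = u"
    "src G' (colift y' u) \<in> fibre (src G u)"
  using lift_fibre[of "ginv G u" y'] assms
  by (simp_all add: colift_def G.gsimps G'.gsimps p1_ginv G.ginv_ginv)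

lemma colift_eqI:
  assumes "a \<in> Ar G'" "tgt G' a = y" "p1 a = u"
  shows "colift y u = a"
proof -
  have "lift y (ginv G u) = ginv G' a"
    by (rule lift_eqI) (use assms in \<open>auto simp: G'.gsimps p1_ginv\<close>)
  then show ?thesis using assms(1) by (simp add: colift_def G'.ginv_ginv)
qed

lemma colift_idt: "x' \<in> Ob G' \<Longrightarrow> p0 x' = x \<Longrightarrow> colift x' (idt G x) = idt G' x'"
  by (rule colift_eqI) (auto simp: homD(5) G'.gsimps)

lemma colift_cmp:
  assumes "u \<in> Ar G" "v \<in> Ar G" "tgt G u = src G v" "z' \<in> fibre (tgt G v)"
  shows "colift z' (cmp G u v) = cmp G' (colift (src G' (colift z' v)) u) (colift z' v)"
proof -
  note v = colift[OF assms(2,4)]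
  have "src G' (colift z' v) \<in> fibre (tgt G u)" using v(4) assms(3) by simp
  note u = colift[OF assms(1) this]
  show ?thesis by (rule colift_eqI) (use u v in \<open>simp_all add: homD(6) G'.gsimps\<close>)
qed

text \<open>The arrow \<open>a\<close> is stored because it is the boundary and cannot be read off
  when the fibre is empty. Requiring \<open>p1 (\<nu> x' k) = a\<close> makes each boundary the lift
  of \<open>a\<close> at \<open>x'\<close>, so where some such lift is not a loop there is no
  element over \<open>a\<close>.\<close>

definition coinduced_family :: "bool \<Rightarrow> ('p, 'b, 'v) gfamily \<Rightarrow> ('p \<Rightarrow> 'v \<Rightarrow> 'b)
    \<Rightarrow> ('o, 'a, 'a \<times> ('p \<Rightarrow> 'v)) gfamily" where
  "coinduced_family A N \<nu> =
     \<lparr>grp = (\<lambda>x. \<lparr>carrier = {(a, n). a \<in> carrier (vertex_group G x) \<and> (A \<longrightarrow> a = idt G x) \<and>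
             n \<in> (\<Pi>\<^sub>E x' \<in> fibre x. {k \<in> carrier (grp N x'). p1 (\<nu> x' k) = a})},
        mult = (\<lambda>m n. (cmp G (fst m) (fst n), \<lambda>x' \<in> fibre x. snd m x' \<otimes>\<^bsub>grp N x'\<^esub> snd n x')),
        one = (idt G x, \<lambda>x' \<in> fibre x. \<one>\<^bsub>grp N x'\<^esub>)\<rparr>),
      act = (\<lambda>m u. (cmp G (cmp G (ginv G u) (fst m)) u,
        \<lambda>y' \<in> fibre (tgt G u). act N (snd m (src G' (colift y' u))) (colift y' u)))\<rparr>"

lemma restricted_coinduced:
  assumes N: "restricted_crossed_module A K' G' N \<nu>"
    and K': "\<And>x'. x' \<in> Ob G' \<Longrightarrow> K' x' \<subseteq> carrier (vertex_group G' x')"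
    and K: "\<And>x k. x \<in> Ob G \<Longrightarrow> K x \<subseteq> carrier (vertex_group G x)"
    and Klift: "\<And>x' k. \<lbrakk>x' \<in> Ob G'; k \<in> K (p0 x')\<rbrakk> \<Longrightarrow> \<exists>k'\<in>K' x'. p1 k' = k"
  shows "restricted_crossed_module A K G (coinduced_family A N \<nu>) (\<lambda>x. fst)"
proof -
  interpret N: crossed_module G' N \<nu> using N by (simp add: restricted_crossed_module_def)
  define C where "C = coinduced_family A N \<nu>"
  have car: "m \<in> carrier (grp C x) \<longleftrightarrow> fst m \<in> Ar G \<and> src G (fst m) = x \<and> tgt G (fst m) = x \<and>
      (A \<longrightarrow> fst m = idt G x) \<and> snd m \<in> extensional (fibre x) \<and>
      (\<forall>x' \<in> fibre x. snd m x' \<in> carrier (grp N x') \<and> p1 (\<nu> x' (snd m x')) = fst m)" for m x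
    by (cases m) (auto simp: C_def coinduced_family_def vertex_group_def PiE_iff)
  have mult: "m \<otimes>\<^bsub>grp C x\<^esub> n = (cmp G (fst m) (fst n), \<lambda>x' \<in> fibre x. snd m x' \<otimes>\<^bsub>grp N x'\<^esub> snd n x')"
    and one: "\<one>\<^bsub>grp C x\<^esub> = (idt G x, \<lambda>x' \<in> fibre x. \<one>\<^bsub>grp N x'\<^esub>)"
    and act: "act C m u = (cmp G (cmp G (ginv G u) (fst m)) u,
        \<lambda>y' \<in> fibre (tgt G u). act N (snd m (src G' (colift y' u))) (colift y' u))" for m n u x
    by (simp_all add: C_def coinduced_family_def)
  have fst: "fst m \<in> Ar G" "src G (fst m) = x" "tgt G (fst m) = x" "snd m \<in> extensional (fibre x)"
    if "m \<in> carrier (grp C x)" for m x using that by (simp_all add: car)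
  have snd: "snd m x' \<in> carrier (grp N x')" "p1 (\<nu> x' (snd m x')) = fst m"
    if "m \<in> carrier (grp C x)" "x' \<in> fibre x" for m x x' using that by (simp_all add: car)
  have A: "fst m = idt G x" if "m \<in> carrier (grp C x)" A for m x using that unfolding car by blast
  have prod_ext: "m = n" if "fst m = fst n" "snd m \<in> extensional (fibre z)" "snd n \<in> extensional (fibre z)"
    "\<And>x'. x' \<in> fibre z \<Longrightarrow> snd m x' = snd n x'" for z and m n :: "'a \<times> ('p \<Rightarrow> 'v)"
    using that by (intro prod_eqI extensionalityI[of _ "fibre z"])
  have mult_closed: "m \<otimes>\<^bsub>grp C x\<^esub> n \<in> carrier (grp C x)"
    if "x \<in> Ob G" "m \<in> carrier (grp C x)" "n \<in> carrier (grp C x)" for x m n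
    unfolding car[of "m \<otimes>\<^bsub>grp C x\<^esub> n"] using that fst[OF that(2)] fst[OF that(3)]
    by (simp add: mult A G.gsimps G.idt_left' snd N.grp_simps fibreD N.bdry_mult N.bdry_closed homD(6))
  let ?inv = "\<lambda>x m. (ginv G (fst m), \<lambda>x' \<in> fibre x. inv\<^bsub>grp N x'\<^esub> snd m x')"
  have inv_closed: "?inv x m \<in> carrier (grp C x)"
    if "x \<in> Ob G" "m \<in> carrier (grp C x)" for x m
    unfolding car[of "?inv x m"] using that fst[OF that(2)]
    by (simp add: A G.gsimps G.ginv_idt snd N.grp_simps fibreD N.bdry_inv N.bdry_closed p1_ginv)
  have one_closed: "\<one>\<^bsub>grp C x\<^esub> \<in> carrier (grp C x)" if "x \<in> Ob G" for x
    unfolding car using that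
    by (simp add: one G.gsimps N.grp_simps fibreD N.bdry_one homD(5))
  have inv_mult: "?inv x m \<otimes>\<^bsub>grp C x\<^esub> m = \<one>\<^bsub>grp C x\<^esub>" if "x \<in> Ob G" "m \<in> carrier (grp C x)" for x m
    by (rule prod_ext[of _ _ x]) (use that fst[OF that(2)] in \<open>simp_all add: mult one G.gsimps snd fibreD N.grp_simps\<close>)
  have group: "group (grp C x)" if x: "x \<in> Ob G" for x
  proof (rule groupI)
    fix l m n assume "l \<in> carrier (grp C x)" "m \<in> carrier (grp C x)" "n \<in> carrier (grp C x)"
    note lmn = this fst[OF this(1)] fst[OF this(2)] fst[OF this(3)]
    show "l \<otimes>\<^bsub>grp C x\<^esub> m \<otimes>\<^bsub>grp C x\<^esub> n = l \<otimes>\<^bsub>grp C x\<^esub> (m \<otimes>\<^bsub>grp C x\<^esub> n)"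
      by (rule prod_ext[of _ _ x]) (use lmn in \<open>simp_all add: mult G.cmp_assoc snd fibreD N.grp_simps\<close>)
  next
    fix m assume "m \<in> carrier (grp C x)"
    note m = this fst[OF this]
    show "\<one>\<^bsub>grp C x\<^esub> \<otimes>\<^bsub>grp C x\<^esub> m = m"
      by (rule prod_ext[of _ _ x]) (use m in \<open>simp_all add: mult one G.idt_left' snd fibreD N.grp_simps\<close>)
    show "\<exists>n\<in>carrier (grp C x). n \<otimes>\<^bsub>grp C x\<^esub> m = \<one>\<^bsub>grp C x\<^esub>"
      using inv_mult inv_closed x m by blast
  qed (use x in \<open>simp_all add: mult_closed one_closed\<close>)
  have inv: "inv\<^bsub>grp C x\<^esub> m = ?inv x m" if "x \<in> Ob G" "m \<in> carrier (grp C x)" for x m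
    by (rule group.inv_equality[OF group]) (use that in \<open>simp_all only: inv_mult inv_closed\<close>)
  have act_closed: "act C m u \<in> carrier (grp C (tgt G u))"
    if u: "u \<in> Ar G" and m: "m \<in> carrier (grp C (src G u))" for u m
  proof -
    \<comment> \<open>The boundary rule of \<open>N\<close> along the colift, projected by
      \<open>p1\<close>, is the conjugation by \<open>u\<close> that defines the new first
      component.\<close>
    have "act N (snd m (src G' (colift y' u))) (colift y' u) \<in> carrier (grp N y') \<and>
        p1 (\<nu> y' (act N (snd m (src G' (colift y' u))) (colift y' u))) = cmp G (cmp G (ginv G u) (fst m)) u"
      if y': "y' \<in> fibre (tgt G u)" for y'
    proof -
      note c = colift[OF u y']
      note s = snd[OF m c(4)] c(4)[THEN fibreD(1)]
      note N.bdry_act[OF c(1) s(1)]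
      with c s N.act_closed[OF c(1) s(1)] show ?thesis
        by (simp add: homD(6) N.bdry_closed G'.gsimps p1_ginv)
    qed
    then show ?thesis
      unfolding car[of "act C m u"] using u m fst[OF m]
      by (simp add: act A G.gsimps G.idt_right')
  qed
  have "crossed_module G C (\<lambda>x. fst)"
  proof (intro crossed_module.intro crossed_module_axioms.intro groupoid_action.intro
    groupoid_action_axioms.intro G.groupoid_axioms group)
    fix u assume u: "u \<in> Ar G"
    show "(\<lambda>m. act C m u) \<in> hom (grp C (src G u)) (grp C (tgt G u))"
    proof (intro homI act_closed[OF u])
      fix m n assume "m \<in> carrier (grp C (src G u))" "n \<in> carrier (grp C (src G u))"
      note mn = this fst[OF this(1)] fst[OF this(2)]
      show "act C (m \<otimes>\<^bsub>grp C (src G u)\<^esub> n) u = act C m u \<otimes>\<^bsub>grp C (tgt G u)\<^esub> act C n u"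
      proof (rule prod_ext[of _ _ "tgt G u"])
        fix y' assume y': "y' \<in> fibre (tgt G u)"
        note c = colift[OF u y']
        show "snd (act C (m \<otimes>\<^bsub>grp C (src G u)\<^esub> n) u) y' =
            snd (act C m u \<otimes>\<^bsub>grp C (tgt G u)\<^esub> act C n u) y'"
          using mn c y' N.act_mult[OF c(1)] by (simp add: act mult snd)
      qed (use mn u in \<open>simp_all add: act mult G.cmp_assoc G.gsimps G.cmp_ginv_right_cancel\<close>)
    qed
    fix m assume m: "m \<in> carrier (grp C (src G u))"
    show "fst (act C m u) = cmp G (cmp G (ginv G u) (fst m)) u" by (simp add: act)
  next
    fix x m assume x: "x \<in> Ob G" and m: "m \<in> carrier (grp C x)"
    show "act C m (idt G x) = m"
      by (rule prod_ext[of _ _ x])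
        (use x m fst[OF m] in \<open>simp_all add: act G.gsimps G.ginv_idt G.idt_left' G.idt_right' fibreD
            colift_idt G'.gsimps snd N.act_idt\<close>)
    fix n assume n: "n \<in> carrier (grp C x)"
    show "inv\<^bsub>grp C x\<^esub> n \<otimes>\<^bsub>grp C x\<^esub> m \<otimes>\<^bsub>grp C x\<^esub> n = act C m (fst n)"
    proof (rule prod_ext[of _ _ x])
      fix x' assume x': "x' \<in> fibre x"
      note b = N.bdry_closed[OF fibreD(1)[OF x'] snd(1)[OF n x']]
      \<comment> \<open>Acting by the boundary of \<open>n\<close> is, in each component, acting by
        the boundary of the component of \<open>n\<close>. The Peiffer rule thus reduces to that of
        \<open>N\<close>.\<close>
      have "colift x' (fst n) = \<nu> x' (snd n x')"
        by (rule colift_eqI) (use b snd[OF n x'] in auto)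
      then show "snd (inv\<^bsub>grp C x\<^esub> n \<otimes>\<^bsub>grp C x\<^esub> m \<otimes>\<^bsub>grp C x\<^esub> n) x' = snd (act C m (fst n)) x'"
        using x x' n fst[OF n] b N.peiffer[OF fibreD(1)[OF x'] snd(1)[OF m x'] snd(1)[OF n x']]
        by (simp add: inv mult act)
    qed (use x m n fst[OF m] fst[OF n] in \<open>simp_all add: inv mult act\<close>)
  next
    fix x assume "x \<in> Ob G"
    then show "fst \<in> hom (grp C x) (vertex_group G x)"
      by (intro homI) (simp_all add: fst vertex_group_def mult)
  next
    fix u v m assume u: "u \<in> Ar G" and v: "v \<in> Ar G" and uv: "tgt G u = src G v"
      and m: "m \<in> carrier (grp C (src G u))"
    show "act C m (cmp G u v) = act C (act C m u) v"
    proof (rule prod_ext[of _ _ "tgt G v"])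
      fix z' assume z': "z' \<in> fibre (tgt G v)"
      note cv = colift[OF v z']
      have y': "src G' (colift z' v) \<in> fibre (tgt G u)" using cv(4) uv by simp
      note cu = colift[OF u y']
      show "snd (act C m (cmp G u v)) z' = snd (act C (act C m u) v) z'"
        using u v uv z' cu cv y' snd(1)[OF m cu(4)]
        by (simp add: act G.gsimps colift_cmp G'.gsimps N.act_cmp)
    qed (use u v uv m fst[OF m] in \<open>simp_all add: act G.gsimps G.ginv_cmp G.cmp_assoc\<close>)
  qed
  moreover have "act C m k = m" if A and x: "x \<in> Ob G" and m: "m \<in> carrier (grp C x)" and k: "k \<in> K x" for x m k
  proof (rule prod_ext[of _ _ x])
    have k': "k \<in> Ar G" "src G k = x" "tgt G k = x" using k K[OF x] by (auto simp: vertex_group_def)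
    show "fst (act C m k) = fst m" using k' m \<open>A\<close> A[OF m] by (simp add: act G.gsimps G.idt_right')
    show "snd (act C m k) \<in> extensional (fibre x)" "snd m \<in> extensional (fibre x)"
      using k' fst[OF m] by (simp_all add: act)
    fix x' assume x': "x' \<in> fibre x"
    \<comment> \<open>The lift of \<open>k\<close> in \<open>K' x'\<close> is a loop, hence it is
      the colift that acts on the component at \<open>x'\<close>, and \<open>K'\<close> acts
      trivially on \<open>N\<close>.\<close>
    obtain h where h: "h \<in> K' x'" "p1 h = k" using Klift[of x' k] x' k by (auto simp: fibreD)
    have h': "h \<in> Ar G'" "src G' h = x'" "tgt G' h = x'"
      using K'[of x'] h x' by (auto simp: vertex_group_def fibreD)
    have "colift x' k = h" by (rule colift_eqI) (use h h' in auto)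
    moreover have "act N (snd m x') h = snd m x'"
      using N \<open>A\<close> h(1) snd(1)[OF m x'] fibreD(1)[OF x'] unfolding restricted_crossed_module_def by blast
    ultimately show "snd (act C m k) x' = snd m x'" using x' k' h' by (simp add: act)
  qed
  ultimately show ?thesis using A by (simp add: C_def[symmetric] restricted_crossed_module_def)
qed

text \<open>The maps \<open>q\<close> identify \<open>M'\<close> with the pullback of
  \<open>M\<close> along the covering. Coinduction being right adjoint to pullback, a morphism from
  \<open>M'\<close> to \<open>N\<close> is the same as one from \<open>M\<close> to the coinduced
  family, where freeness of \<open>M\<close> applies.\<close>

lemma free_restricted_covering:
  fixes M :: "('o, 'a, 'm) gfamily" and M' :: "('p, 'b, 'n) gfamily"
  assumes free: "free_restricted_on TYPE(('o, 'a, 'm) word_universe) A K G S M \<mu>"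
    and M': "restricted_crossed_module A K' G' M' \<mu>'"
    and K: "\<And>x k. x \<in> Ob G \<Longrightarrow> K x \<subseteq> carrier (vertex_group G x)"
    and K': "\<And>x'. x' \<in> Ob G' \<Longrightarrow> K' x' \<subseteq> carrier (vertex_group G' x')"
    and Klift: "\<And>x' k. \<lbrakk>x' \<in> Ob G'; k \<in> K (p0 x')\<rbrakk> \<Longrightarrow> \<exists>k'\<in>K' x'. p1 k' = k"
    and q: "\<And>x'. x' \<in> Ob G' \<Longrightarrow> q x' \<in> iso (grp M' x') (grp M (p0 x'))"
    and q_act: "\<And>u m. \<lbrakk>u \<in> Ar G'; m \<in> carrier (grp M' (src G' u))\<rbrakk>
          \<Longrightarrow> q (tgt G' u) (act M' m u) = act M (q (src G' u) m) (p1 u)"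
    and q_bdry: "\<And>x' m. \<lbrakk>x' \<in> Ob G'; m \<in> carrier (grp M' x')\<rbrakk> \<Longrightarrow> p1 (\<mu>' x' m) = \<mu> (p0 x') (q x' m)"
  shows "free_restricted_on TYPE('u) A K' G' (\<lambda>x'. {m \<in> carrier (grp M' x'). q x' m \<in> S (p0 x')}) M' \<mu>'"
  unfolding free_restricted_on_def
proof (intro conjI allI impI M'; (elim conjE)?)
  let ?S = "\<lambda>x'. {m \<in> carrier (grp M' x'). q x' m \<in> S (p0 x')}"
  fix N :: "('p, 'b, 'u) gfamily" and \<nu> g
  assume N: "restricted_crossed_module A K' G' N \<nu>"
    and g: "\<forall>x\<in>Ob G'. \<forall>s\<in>?S x. g x s \<in> carrier (grp N x) \<and> \<nu> x (g x s) = \<mu>' x s"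
  interpret M: crossed_module G M \<mu>
    using free by (simp add: free_restricted_on_def restricted_crossed_module_def)
  interpret M': crossed_module G' M' \<mu>' using M' by (simp add: restricted_crossed_module_def)
  interpret N: crossed_module G' N \<nu> using N by (simp add: restricted_crossed_module_def)
  let ?C = "coinduced_family A N \<nu>"
  have C: "restricted_crossed_module A K G ?C (\<lambda>x. fst)"
    using N K' K Klift by (rule restricted_coinduced)
  have S: "s \<in> carrier (grp M x)" if "x \<in> Ob G" "s \<in> S x" for x s
    using free that by (auto simp: free_restricted_on_def)
  have q_closed: "q x' m \<in> carrier (grp M (p0 x'))"
    and q_mult: "n \<in> carrier (grp M' x') \<Longrightarrow> q x' (m \<otimes>\<^bsub>grp M' x'\<^esub> n) = q x' m \<otimes>\<^bsub>grp M (p0 x')\<^esub> q x' n"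
    if "x' \<in> Ob G'" "m \<in> carrier (grp M' x')" for x' m n
    using q[OF that(1)] that(2) by (auto simp: iso_def hom_def)
  define r where "r = (\<lambda>x'. inv_into (carrier (grp M' x')) (q x'))"
  have r: "r x' m \<in> carrier (grp M' x')" "q x' (r x' m) = m"
    if "x' \<in> Ob G'" "m \<in> carrier (grp M (p0 x'))" for x' m
  proof -
    have "m \<in> q x' ` carrier (grp M' x')" using q[OF that(1)] that(2) by (auto simp: iso_def bij_betw_def)
    then show "r x' m \<in> carrier (grp M' x')" "q x' (r x' m) = m"
      unfolding r_def by (auto intro: inv_into_into f_inv_into_f)
  qed
  have r_eqI: "r x' m = n" if "x' \<in> Ob G'" "n \<in> carrier (grp M' x')" "q x' n = m" for x' m n
    using q[OF that(1)] that unfolding r_def by (auto simp: iso_def bij_betw_def)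
  \<comment> \<open>A basis element \<open>s\<close> has one preimage in \<open>M'\<close> at each
    point of the fibre; the values of \<open>g\<close> there form a family over the boundary of
    \<open>s\<close>.\<close>
  define c where "c = (\<lambda>x s. (\<mu> x s, \<lambda>x' \<in> fibre x. g x' (r x' s)))"
  have c: "c x s \<in> carrier (grp ?C x) \<and> fst (c x s) = \<mu> x s" if "x \<in> Ob G" "s \<in> S x" for x s
  proof -
    have "A \<longrightarrow> \<mu> x s = idt G x"
      using free S[OF that] that(1) by (auto simp: free_restricted_on_def restricted_crossed_module_def)
    moreover have "g x' (r x' s) \<in> carrier (grp N x') \<and> p1 (\<nu> x' (g x' (r x' s))) = \<mu> x s"
      if x': "x' \<in> fibre x" for x'
    proof -
      have "r x' s \<in> ?S x'" "x' \<in> Ob G'" "p0 x' = x"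
        using r[of x' s] S[OF \<open>x \<in> Ob G\<close> \<open>s \<in> S x\<close>] \<open>s \<in> S x\<close> x' by (auto simp: fibreD)
      then show ?thesis using g q_bdry[of x' "r x' s"] r[of x' s] S[OF \<open>x \<in> Ob G\<close> \<open>s \<in> S x\<close>] by simp
    qed
    ultimately show ?thesis
      using M.bdry_closed[OF that(1) S[OF that]] by (auto simp: c_def coinduced_family_def vertex_group_def)
  qed
  obtain F where F: "crossed_module_hom G M \<mu> ?C (\<lambda>x. fst) F" "\<And>x s. \<lbrakk>x \<in> Ob G; s \<in> S x\<rbrakk> \<Longrightarrow> F x s = c x s"
    using free_restricted_extend[OF free K C c] by blast
  note FD = crossed_module_homD[OF F(1)] crossed_module_hom_act[OF F(1)]
  define F' where "F' = (\<lambda>x' m. snd (F (p0 x') (q x' m)) x')"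
  have self: "x' \<in> fibre (p0 x')" if "x' \<in> Ob G'" for x' using that by (simp add: fibre_def)
  have F'_val: "F' x' m \<in> carrier (grp N x')" "\<nu> x' (F' x' m) = \<mu>' x' m"
    if x': "x' \<in> Ob G'" and m: "m \<in> carrier (grp M' x')" for x' m
  proof -
    have "F (p0 x') (q x' m) \<in> carrier (grp ?C (p0 x'))"
      and fst: "fst (F (p0 x') (q x' m)) = \<mu> (p0 x') (q x' m)"
      using FD(2,4)[OF homD(1)[OF x'] q_closed[OF x' m]] by auto
    \<comment> \<open>The coinduced family controls only the image in \<open>G\<close> of the
      boundary of \<open>F' x' m\<close>. Equality in \<open>G'\<close> follows because arrows with
      the same source and the same image coincide.\<close>
    then show "F' x' m \<in> carrier (grp N x')"
      and "\<nu> x' (F' x' m) = \<mu>' x' m"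
      using self[OF x'] q_bdry[OF x' m] N.bdry_closed[OF x'] M'.bdry_closed[OF x' m]
      by (auto simp: coinduced_family_def F'_def PiE_iff intro!: p1_inj)
  qed
  have F': "crossed_module_hom G' M' \<mu>' N \<nu> F'"
    unfolding crossed_module_hom_def gfamily_hom_def
  proof (intro conjI ballI homI F'_val)
    fix x' m n assume x': "x' \<in> Ob G'" and m: "m \<in> carrier (grp M' x')" and n: "n \<in> carrier (grp M' x')"
    show "F' x' (m \<otimes>\<^bsub>grp M' x'\<^esub> n) = F' x' m \<otimes>\<^bsub>grp N x'\<^esub> F' x' n"
      using FD(3)[OF homD(1)[OF x'] q_closed[OF x' m] q_closed[OF x' n]] self[OF x']
      by (simp add: F'_def q_mult[OF x' m n]) (simp add: coinduced_family_def)
  next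
    fix u m assume u: "u \<in> Ar G'" and m: "m \<in> carrier (grp M' (src G' u))"
    \<comment> \<open>So the component at \<open>tgt G' u\<close> of the translate along
      \<open>p1 u\<close> is the translate along \<open>u\<close> itself.\<close>
    have "colift (tgt G' u) (p1 u) = u" by (rule colift_eqI) (use u in auto)
    then show "F' (tgt G' u) (act M' m u) = act N (F' (src G' u) m) u"
      using FD(5)[OF homD(2)[OF u], of "q (src G' u) m"] self[OF G'.tgt_closed[OF u]] u m
      by (simp add: F'_def q_act q_closed homD G'.gsimps) (simp add: coinduced_family_def homD)
  qed
  have agree: "F' x' s = g x' s" if "x' \<in> Ob G'" "s \<in> ?S x'" for x' s
    using that F(2)[OF homD(1)[OF that(1)], of "q x' s"] self[OF that(1)] r_eqI[of x' s "q x' s"]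
    by (simp add: F'_def c_def)
  have unique: "F'' x' m = F' x' m"
    if F'': "crossed_module_hom G' M' \<mu>' N \<nu> F''" "\<forall>x\<in>Ob G'. \<forall>s\<in>?S x. F'' x s = g x s"
      and x': "x' \<in> Ob G'" and m: "m \<in> carrier (grp M' x')" for F'' x' m
  proof -
    note D = crossed_module_homD[OF F'] crossed_module_homD[OF F''(1)]
      crossed_module_hom_act[OF F'] crossed_module_hom_act[OF F''(1)]
      crossed_module_hom_one_inv[OF F' M'.groupoid_action_axioms N.groupoid_action_axioms]
      crossed_module_hom_one_inv[OF F''(1) M'.groupoid_action_axioms N.groupoid_action_axioms]
    \<comment> \<open>Agreement is demanded at all preimages of an element, so that it becomes a
      subfamily of \<open>M\<close>, over which the basis is known to generate.\<close>
    let ?D = "\<lambda>x. {m \<in> carrier (grp M x). \<forall>x'\<in>fibre x. F'' x' (r x' m) = F' x' (r x' m)}"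
    have r': "r x' m \<in> carrier (grp M' x')" "q x' (r x' m) = m" "x' \<in> Ob G'" "p0 x' = x"
      if "x' \<in> fibre x" "m \<in> carrier (grp M x)" for x x' m
      using that r[of x' m] by (auto simp: fibreD)
    have q_hom: "group_hom (grp M' x') (grp M (p0 x')) (q x')" if "x' \<in> Ob G'" for x'
      using q[OF that] that M.grp_group[OF homD(1)] M'.grp_group
      by (intro group_hom.intro group_hom_axioms.intro) (auto simp: iso_def)
    have "subfamily G M ?D"
      unfolding subfamily_def
    proof (intro conjI ballI)
      fix x assume x: "x \<in> Ob G"
      have "r x' \<one>\<^bsub>grp M x\<^esub> = \<one>\<^bsub>grp M' x'\<^esub>" if "x' \<in> fibre x" for x'
        by (rule r_eqI) (use that group_hom.hom_one[OF q_hom, of x'] in \<open>auto simp: fibreD M'.grp_simps\<close>)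
      then show "\<one>\<^bsub>grp M x\<^esub> \<in> ?D x" using x by (simp add: M.grp_simps D fibreD)
      fix m assume m: "m \<in> ?D x"
      have "r x' (inv\<^bsub>grp M x\<^esub> m) = inv\<^bsub>grp M' x'\<^esub> (r x' m)" if "x' \<in> fibre x" for x'
        by (rule r_eqI) (use m that group_hom.hom_inv[OF q_hom, of x' "r x' m"] r'[OF that, of m]
            in \<open>auto simp: M'.grp_simps\<close>)
      then show "inv\<^bsub>grp M x\<^esub> m \<in> ?D x" using x m r'[of _ x m] by (simp add: M.grp_simps D)
      fix n assume n: "n \<in> ?D x"
      have "r x' (m \<otimes>\<^bsub>grp M x\<^esub> n) = r x' m \<otimes>\<^bsub>grp M' x'\<^esub> r x' n" if "x' \<in> fibre x" for x'
        by (rule r_eqI) (use m n that r'[OF that, of m] r'[OF that, of n] q_mult[of x' "r x' m" "r x' n"]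
            in \<open>auto simp: M'.grp_simps\<close>)
      then show "m \<otimes>\<^bsub>grp M x\<^esub> n \<in> ?D x" using x m n r'[of _ x m] r'[of _ x n] by (simp add: M.grp_simps D)
    next
      fix u m assume u: "u \<in> Ar G" and m: "m \<in> ?D (src G u)"
      have "F'' y' (r y' (act M m u)) = F' y' (r y' (act M m u))" if y': "y' \<in> fibre (tgt G u)" for y'
      proof -
        note c = colift[OF u y']
        have m': "m \<in> carrier (grp M (src G u))" using m by simp
        note rm = r'[OF c(4) m']
        have "r y' (act M m u) = act M' (r (src G' (colift y' u)) m) (colift y' u)"
          by (rule r_eqI)
            (use c rm y' M'.act_closed[OF c(1), of "r (src G' (colift y' u)) m"]
              q_act[OF c(1), of "r (src G' (colift y' u)) m"] in \<open>auto simp: fibreD\<close>)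
        moreover have "F'' y' (act M' n (colift y' u)) = act N (F'' (src G' (colift y' u)) n) (colift y' u)"
          "F' y' (act M' n (colift y' u)) = act N (F' (src G' (colift y' u)) n) (colift y' u)"
          if "n \<in> carrier (grp M' (src G' (colift y' u)))" for n
          using D(9)[OF c(1) that] D(10)[OF c(1) that] c(2) by simp_all
        ultimately show ?thesis using m c(4) rm by simp
      qed
      then show "act M m u \<in> ?D (tgt G u)" using u m by (simp add: M.act_closed)
    qed auto
    moreover have "S x \<subseteq> ?D x" if "x \<in> Ob G" for x
    proof
      fix s assume s: "s \<in> S x"
      have "F'' x' (r x' s) = F' x' (r x' s)" if "x' \<in> fibre x" for x'
        using r'[OF that S[OF \<open>x \<in> Ob G\<close> s]] s F''(2) agree by simp
      then show "s \<in> ?D x" using S[OF that s] by simp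
    qed
    moreover have "inj (\<lambda>m :: 'm. {[Inr (Inr m)] :: ('o + 'a + 'm) list})" by (auto simp: inj_def)
    ultimately have "?D (p0 x') = carrier (grp M (p0 x'))"
      using free_restricted_generated[OF free, of "\<lambda>m. {[Inr (Inr m)]}" ?D "p0 x'"] K homD(1)[OF x'] by simp
    then have "q x' m \<in> ?D (p0 x')" using q_closed[OF x' m] by simp
    moreover have "r x' (q x' m) = m" by (rule r_eqI) (use x' m in auto)
    ultimately show ?thesis using self[OF x'] by auto
  qed
  show "\<exists>F. crossed_module_hom G' M' \<mu>' N \<nu> F \<and> (\<forall>x\<in>Ob G'. \<forall>s\<in>?S x. F x s = g x s) \<and>
      (\<forall>F'. crossed_module_hom G' M' \<mu>' N \<nu> F' \<and> (\<forall>x\<in>Ob G'. \<forall>s\<in>?S x. F' x s = g x s) \<longrightarrow>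
         (\<forall>x\<in>Ob G'. \<forall>m\<in>carrier (grp M' x). F' x m = F x m))"
    by (rule exI[of _ F']) (use F' agree unique in blast)
qed auto

end

section \<open>Modules over the fundamental groupoid\<close>

locale normal_subgroupoid = groupoid G for G :: "('o, 'a) groupoid" +
  fixes N :: "'o \<Rightarrow> 'a set"
  assumes N_vertex: "x \<in> Ob G \<Longrightarrow> N x \<subseteq> carrier (vertex_group G x)"
    and N_idt: "x \<in> Ob G \<Longrightarrow> idt G x \<in> N x"
    and N_cmp: "\<lbrakk>x \<in> Ob G; h \<in> N x; k \<in> N x\<rbrakk> \<Longrightarrow> cmp G h k \<in> N x"
    and N_ginv: "\<lbrakk>x \<in> Ob G; k \<in> N x\<rbrakk> \<Longrightarrow> ginv G k \<in> N x"
    and N_conj: "\<lbrakk>u \<in> Ar G; k \<in> N (src G u)\<rbrakk> \<Longrightarrow> cmp G (cmp G (ginv G u) k) u \<in> N (tgt G u)"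
begin

abbreviation "Q \<equiv> quotient_groupoid G N"

abbreviation "q \<equiv> gcoset G N"

lemma N: "\<lbrakk>x \<in> Ob G; k \<in> N x\<rbrakk> \<Longrightarrow> k \<in> Ar G" "\<lbrakk>x \<in> Ob G; k \<in> N x\<rbrakk> \<Longrightarrow> src G k = x"
    "\<lbrakk>x \<in> Ob G; k \<in> N x\<rbrakk> \<Longrightarrow> tgt G k = x"
  using N_vertex by (auto simp: vertex_group_def)

lemma gcoset_self: "u \<in> Ar G \<Longrightarrow> u \<in> q u"
  unfolding gcoset_def by (rule image_eqI[of _ _ "idt G (src G u)"]) (simp_all add: gsimps N_idt)

lemma gcosetD:
  assumes "u \<in> Ar G" "v \<in> q u"
  shows "v \<in> Ar G" "src G v = src G u" "tgt G v = tgt G u"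
proof -
  obtain k where k: "k \<in> N (src G u)" "v = cmp G k u" using assms(2) unfolding gcoset_def by blast
  note N[OF src_closed[OF assms(1)] k(1)]
  then show "v \<in> Ar G" "src G v = src G u" "tgt G v = tgt G u"
    using assms(1) k(2) by (simp_all add: cmp_closed src_cmp tgt_cmp)
qed

lemma gcoset_eq:
  assumes u: "u \<in> Ar G" and v: "v \<in> q u"
  shows "q v = q u"
proof -
  obtain n where n: "n \<in> N (src G u)" "v = cmp G n u" using v by (auto simp: gcoset_def)
  have x: "src G u \<in> Ob G" using u by (simp add: gsimps)
  note n' = N[OF x n(1)]
  have "cmp G k v = cmp G (cmp G k n) u" "cmp G k u = cmp G (cmp G k (ginv G n)) v" if "k \<in> N (src G u)" for k
    using N[OF x that] n' n u by (simp_all add: cmp_assoc gsimps cmp_ginv_left_cancel)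
  moreover have "cmp G k n \<in> N (src G u)" "cmp G k (ginv G n) \<in> N (src G u)" if "k \<in> N (src G u)" for k
    using that n x by (auto intro: N_cmp N_ginv)
  ultimately show ?thesis
    unfolding gcoset_def gcosetD(2)[OF assms] image_def by blast
qed

lemma Q_sel:
  "Ob Q = Ob G" "Ar Q = q ` Ar G" "idt Q x = q (idt G x)"
  "u \<in> Ar G \<Longrightarrow> src Q (q u) = src G u" "u \<in> Ar G \<Longrightarrow> tgt Q (q u) = tgt G u"
proof -
  show "Ob Q = Ob G" "Ar Q = q ` Ar G" "idt Q x = q (idt G x)" by (simp_all add: quotient_groupoid_def)
  assume u: "u \<in> Ar G"
  have "src G ` q u = {src G u}" "tgt G ` q u = {tgt G u}"
    using gcosetD(2,3)[OF u] gcoset_self[OF u] by (blast intro: sym)+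
  then show "src Q (q u) = src G u" "tgt Q (q u) = tgt G u"
    by (simp_all add: quotient_groupoid_def)
qed

text \<open>Normality moves the middle factor to the front: with \<open>m\<close> and
  \<open>n\<close> in the subgroupoid, m u n v = m (u n u^-1) u v.\<close>

lemma cmp_Q:
  assumes u: "u \<in> Ar G" and v: "v \<in> Ar G" and uv: "tgt G u = src G v"
  shows "cmp Q (q u) (q v) = q (cmp G u v)"
proof -
  have x: "src G u \<in> Ob G" and y: "src G v \<in> Ob G" using u v by (simp_all add: gsimps)
  have "cmp G (cmp G m u) (cmp G n v) \<in> q (cmp G u v)" if m: "m \<in> N (src G u)" and n: "n \<in> N (src G v)" for m n
  proof -
    have "cmp G (cmp G (ginv G (ginv G u)) n) (ginv G u) \<in> N (src G u)"
      using N_conj[of "ginv G u" n] u n uv by (simp add: gsimps)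
    then have "cmp G m (cmp G (cmp G u n) (ginv G u)) \<in> N (src G u)"
      using m x u by (simp add: ginv_ginv N_cmp)
    moreover have "cmp G (cmp G m u) (cmp G n v) = cmp G (cmp G m (cmp G (cmp G u n) (ginv G u))) (cmp G u v)"
      using N[OF x m] N[OF y n] u v uv by (simp add: cmp_assoc gsimps cmp_ginv_left_cancel)
    ultimately show ?thesis using u v uv by (auto simp: gcoset_def gsimps)
  qed
  moreover have "cmp G n (cmp G u v) \<in> {cmp G a b |a b. a \<in> q u \<and> b \<in> q v}" if n: "n \<in> N (src G u)" for n
  proof -
    have "cmp G n (cmp G u v) = cmp G (cmp G n u) v" using N[OF x n] u v uv by (simp add: cmp_assoc)
    then show ?thesis using n gcoset_self[OF v] by (auto simp: gcoset_def)
  qed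
  ultimately show ?thesis
    using u v uv by (auto simp: quotient_groupoid_def gcoset_def gsimps)
qed

lemma groupoid_Q: "groupoid Q"
proof
  fix U assume "U \<in> Ar Q"
  then obtain u where "u \<in> Ar G" "U = q u" by (auto simp: Q_sel)
  then show "\<exists>V. is_ginv Q U V"
    by (intro exI[of _ "q (ginv G u)"]) (simp add: is_ginv_def Q_sel cmp_Q gsimps)
qed (auto simp: Q_sel cmp_Q gsimps idt_left' idt_right' cmp_assoc)

definition acts_trivially :: "('o, 'a, 'm) gfamily \<Rightarrow> bool" where
  "acts_trivially M \<longleftrightarrow> (\<forall>x\<in>Ob G. \<forall>m\<in>carrier (grp M x). \<forall>k\<in>N x. act M m k = m)"

lemma restricted_iff_module:
  "restricted_crossed_module True N G M \<mu> \<longleftrightarrow>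
    groupoid_module G M \<and> acts_trivially M \<and> (\<forall>x\<in>Ob G. \<forall>m\<in>carrier (grp M x). \<mu> x m = idt G x)"
proof
  assume M: "restricted_crossed_module True N G M \<mu>"
  then interpret crossed_module G M \<mu> by (simp add: restricted_crossed_module_def)
  have \<mu>: "\<mu> x m = idt G x" if "x \<in> Ob G" "m \<in> carrier (grp M x)" for x m
    using M that by (simp add: restricted_crossed_module_def)
  have "comm_group (grp M x)" if x: "x \<in> Ob G" for x
  proof (rule group.group_comm_groupI[OF grp_group[OF x]])
    fix m n assume mn: "m \<in> carrier (grp M x)" "n \<in> carrier (grp M x)"
    interpret X: group "grp M x" using x by (rule grp_group)
    have "inv\<^bsub>grp M x\<^esub> n \<otimes>\<^bsub>grp M x\<^esub> m \<otimes>\<^bsub>grp M x\<^esub> n = m"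
      using peiffer[OF x mn] \<mu>[OF x mn(2)] act_idt[OF x mn(1)] by simp
    then have "n \<otimes>\<^bsub>grp M x\<^esub> (inv\<^bsub>grp M x\<^esub> n \<otimes>\<^bsub>grp M x\<^esub> m \<otimes>\<^bsub>grp M x\<^esub> n) = n \<otimes>\<^bsub>grp M x\<^esub> m" by simp
    then show "m \<otimes>\<^bsub>grp M x\<^esub> n = n \<otimes>\<^bsub>grp M x\<^esub> m"
      using mn by (simp add: X.m_assoc[symmetric])
  qed
  then have "groupoid_module G M"
    by (intro groupoid_module.intro groupoid_module_axioms.intro groupoid_action_axioms)
  with M \<mu> show "groupoid_module G M \<and> acts_trivially M \<and>
      (\<forall>x\<in>Ob G. \<forall>m\<in>carrier (grp M x). \<mu> x m = idt G x)"
    by (simp add: restricted_crossed_module_def acts_trivially_def)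
next
  assume M: "groupoid_module G M \<and> acts_trivially M \<and> (\<forall>x\<in>Ob G. \<forall>m\<in>carrier (grp M x). \<mu> x m = idt G x)"
  then interpret groupoid_module G M by simp
  have \<mu>: "\<mu> x m = idt G x" if "x \<in> Ob G" "m \<in> carrier (grp M x)" for x m using M that by simp
  have "crossed_module G M \<mu>"
  proof (intro crossed_module.intro crossed_module_axioms.intro groupoid_action_axioms)
    show "\<mu> x \<in> hom (grp M x) (vertex_group G x)" if "x \<in> Ob G" for x
      using that by (auto simp: hom_def \<mu> grp_simps vertex_group_def gsimps idt_left')
    show "\<mu> (tgt G u) (act M m u) = cmp G (cmp G (ginv G u) (\<mu> (src G u) m)) u"
      if "u \<in> Ar G" "m \<in> carrier (grp M (src G u))" for u m
      using that by (simp add: \<mu> gsimps act_closed idt_right')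
    fix x m n assume x: "x \<in> Ob G" and mn: "m \<in> carrier (grp M x)" "n \<in> carrier (grp M x)"
    interpret X: comm_group "grp M x" using x by (rule grp_comm)
    have "inv\<^bsub>grp M x\<^esub> n \<otimes>\<^bsub>grp M x\<^esub> m \<otimes>\<^bsub>grp M x\<^esub> n = m"
      using mn by (simp add: X.m_assoc X.m_comm[of m n]) (simp add: X.m_assoc[symmetric])
    then show "inv\<^bsub>grp M x\<^esub> n \<otimes>\<^bsub>grp M x\<^esub> m \<otimes>\<^bsub>grp M x\<^esub> n = act M m (\<mu> x n)"
      using x mn by (simp add: \<mu> act_idt)
  qed
  then show "restricted_crossed_module True N G M \<mu>"
    using M by (simp add: restricted_crossed_module_def acts_trivially_def)
qed

lemma module_hom_iff:
  assumes "restricted_crossed_module True N G M \<mu>" "restricted_crossed_module True N G L \<nu>"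
  shows "crossed_module_hom G M \<mu> L \<nu> f \<longleftrightarrow> gfamily_hom G M L f"
proof -
  have "\<nu> x (f x m) = \<mu> x m" if "gfamily_hom G M L f" "x \<in> Ob G" "m \<in> carrier (grp M x)" for x m
  proof -
    have "f x m \<in> carrier (grp L x)" using that by (auto simp: gfamily_hom_def hom_def)
    then show ?thesis using assms that(2,3) by (simp add: restricted_crossed_module_def)
  qed
  then show ?thesis unfolding crossed_module_hom_def by blast
qed

text \<open>The formula of \<open>pi1_family\<close>, for any family over \<open>G\<close>; it is
  meaningful when \<open>N\<close> acts trivially.\<close>

definition quotient_family :: "('o, 'a, 'm) gfamily \<Rightarrow> ('o, 'a set, 'm) gfamily" where
  "quotient_family M = \<lparr>grp = grp M, act = (\<lambda>m U. the_elem ((\<lambda>u. act M m u) ` U))\<rparr>"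

definition pulled_family :: "('o, 'a set, 'm) gfamily \<Rightarrow> ('o, 'a, 'm) gfamily" where
  "pulled_family L = \<lparr>grp = grp L, act = (\<lambda>m u. act L m (q u))\<rparr>"

lemma grp_families: "grp (quotient_family M) = grp M" "grp (pulled_family L) = grp L"
  and act_pulled: "act (pulled_family L) m u = act L m (q u)"
  by (simp_all add: quotient_family_def pulled_family_def)

text \<open>Any representative of the coset has the form k u with \<open>k\<close> in
  \<open>N\<close>, and acting by k first changes nothing. So \<open>the_elem\<close> is applied to
  a singleton.\<close>

lemma act_quotient:
  assumes "groupoid_action G M" "acts_trivially M" "u \<in> Ar G" "m \<in> carrier (grp M (src G u))"
  shows "act (quotient_family M) m (q u) = act M m u"
proof -
  interpret M: groupoid_action G M by fact
  have const: "act M m v = act M m u" if v: "v \<in> q u" for v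
  proof -
    obtain k where k: "k \<in> N (src G u)" "v = cmp G k u" using v by (auto simp: gcoset_def)
    note k' = N[OF src_closed[OF assms(3)] k(1)]
    have "act M m k = m" using assms(2-4) k(1) src_closed unfolding acts_trivially_def by blast
    then show ?thesis using M.act_cmp[OF k'(1) assms(3)] k' k assms(4) by simp
  qed
  have "act M m ` q u = (\<lambda>_. act M m u) ` q u" by (rule image_cong[OF refl const])
  also have "\<dots> = {act M m u}" by (rule image_constant[OF gcoset_self[OF assms(3)]])
  finally show ?thesis by (simp add: quotient_family_def)
qed

lemma module_quotient:
  assumes M: "groupoid_module G M" "acts_trivially M"
  shows "groupoid_module Q (quotient_family M)"
proof -
  interpret M: groupoid_module G M by fact
  note act = act_quotient[OF M.groupoid_action_axioms M(2)]
  show ?thesis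
  proof (intro groupoid_module.intro groupoid_module_axioms.intro groupoid_action.intro
      groupoid_action_axioms.intro groupoid_Q)
    fix U assume "U \<in> Ar Q"
    then obtain u where "u \<in> Ar G" "U = q u" by (auto simp: Q_sel)
    then show "(\<lambda>m. act (quotient_family M) m U) \<in> hom (grp (quotient_family M) (src Q U)) (grp (quotient_family M) (tgt Q U))"
      by (simp add: hom_def Q_sel grp_families act M.act_closed M.act_mult M.grp_simps gsimps)
  next
    fix U V m assume "U \<in> Ar Q" "V \<in> Ar Q" "tgt Q U = src Q V" "m \<in> carrier (grp (quotient_family M) (src Q U))"
    then obtain u v where "u \<in> Ar G" "U = q u" "v \<in> Ar G" "V = q v" "tgt G u = src G v" "m \<in> carrier (grp M (src G u))"
      by (auto simp: Q_sel grp_families)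
    then show "act (quotient_family M) m (cmp Q U V) = act (quotient_family M) (act (quotient_family M) m U) V"
      using M.act_closed[of u m] by (simp add: cmp_Q act gsimps M.act_cmp)
  qed (simp_all add: Q_sel grp_families M.grp_group M.grp_comm act gsimps M.act_idt)
qed

text \<open>Stated for a pair \<open>L\<close>, \<open>L'\<close> whose actions correspond, so that
  it covers both passages between test modules: from \<open>G\<close> down to the quotient, and from
  the quotient back up to \<open>G\<close>.\<close>

lemma quotient_hom_iff:
  assumes "groupoid_module G M" "acts_trivially M"
    and "\<And>u m. \<lbrakk>u \<in> Ar G; m \<in> carrier (grp L (src G u))\<rbrakk> \<Longrightarrow> act L m (q u) = act L' m u" and "grp L' = grp L"
  shows "gfamily_hom Q (quotient_family M) L f \<longleftrightarrow> gfamily_hom G M L' f"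
proof -
  interpret M: groupoid_module G M by fact
  show ?thesis
    unfolding gfamily_hom_def
    using assms(3,4) act_quotient[OF M.groupoid_action_axioms assms(2)]
    by (auto simp: Q_sel grp_families gsimps hom_def Pi_iff)
qed

lemma restricted_pulled:
  assumes L: "groupoid_module Q L"
  shows "restricted_crossed_module True N G (pulled_family L) (\<lambda>x m. idt G x)"
proof -
  interpret L: groupoid_module Q L by fact
  have "groupoid_module G (pulled_family L)"
  proof (intro groupoid_module.intro groupoid_module_axioms.intro groupoid_action.intro
      groupoid_action_axioms.intro groupoid_axioms)
    fix u assume "u \<in> Ar G"
    then show "(\<lambda>m. act (pulled_family L) m u) \<in> hom (grp (pulled_family L) (src G u)) (grp (pulled_family L) (tgt G u))"
      using L.act_hom[of "q u"] by (simp add: Q_sel grp_families act_pulled)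
  next
    fix u v m assume "u \<in> Ar G" "v \<in> Ar G" "tgt G u = src G v" "m \<in> carrier (grp (pulled_family L) (src G u))"
    then show "act (pulled_family L) m (cmp G u v) = act (pulled_family L) (act (pulled_family L) m u) v"
      using L.act_cmp[of "q u" "q v" m] by (simp add: Q_sel grp_families act_pulled cmp_Q)
  next
    fix x m assume "x \<in> Ob G" "m \<in> carrier (grp (pulled_family L) x)"
    then show "act (pulled_family L) m (idt G x) = m"
      using L.act_idt[of x m] by (simp add: Q_sel grp_families act_pulled)
  qed (use L.grp_group L.grp_comm in \<open>simp_all add: Q_sel grp_families\<close>)
  moreover have "acts_trivially (pulled_family L)"
    unfolding acts_trivially_def
  proof (intro ballI)
    fix x m k assume x: "x \<in> Ob G" and m: "m \<in> carrier (grp (pulled_family L) x)" and k: "k \<in> N x"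
    \<comment> \<open>An element of \<open>N x\<close> is in the coset of the identity, so it acts
      through an identity of the quotient.\<close>
    have "k \<in> q (idt G x)" using x k N[OF x k] idt_right'[of k x] by (force simp: gcoset_def gsimps)
    then have "q k = q (idt G x)" using gcoset_eq x by (simp add: gsimps)
    then show "act (pulled_family L) m k = m"
      using L.act_idt[of x m] x m by (simp add: Q_sel grp_families act_pulled)
  qed
  ultimately show ?thesis by (simp add: restricted_iff_module)
qed

text \<open>\<open>quotient_family\<close> and \<open>pulled_family\<close> turn the test modules of
  either side into those of the other. Both keep the underlying groups, so although the type of
  arrows changes, the equivalence holds within each universe \<open>'u\<close> separately.\<close>

lemma free_module_iff_restricted:
  fixes M :: "('o, 'a, 'm) gfamily"
  assumes M: "groupoid_module G M" "acts_trivially M"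
  shows "free_module_on TYPE('u) Q (quotient_family M) S \<longleftrightarrow>
    free_restricted_on TYPE('u) True N G S M (\<lambda>x m. idt G x)" (is "?L \<longleftrightarrow> ?R")
proof
  have R: "restricted_crossed_module True N G M (\<lambda>x m. idt G x)"
    using M by (simp add: restricted_iff_module)
  show ?R if L: ?L
    unfolding free_restricted_on_def
  proof (intro conjI R allI impI; (elim conjE)?)
    show "\<forall>x\<in>Ob G. S x \<subseteq> carrier (grp M x)"
      using L by (simp add: free_module_on_def Q_sel grp_families)
    fix T :: "('o, 'a, 'u) gfamily" and \<nu> g
    assume T: "restricted_crossed_module True N G T \<nu>"
      and g: "\<forall>x\<in>Ob G. \<forall>s\<in>S x. g x s \<in> carrier (grp T x) \<and> \<nu> x (g x s) = idt G x"
    have T': "groupoid_module G T" "acts_trivially T" using T by (simp_all add: restricted_iff_module)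
    have hom: "gfamily_hom Q (quotient_family M) (quotient_family T) f \<longleftrightarrow>
        crossed_module_hom G M (\<lambda>x m. idt G x) T \<nu> f" for f
      unfolding module_hom_iff[OF R T]
      by (rule quotient_hom_iff[OF M act_quotient[OF groupoid_module.axioms(1)[OF T'(1)] T'(2)]])
        (simp_all add: grp_families)
    show "\<exists>F. crossed_module_hom G M (\<lambda>x m. idt G x) T \<nu> F \<and> (\<forall>x\<in>Ob G. \<forall>s\<in>S x. F x s = g x s) \<and>
       (\<forall>F'. crossed_module_hom G M (\<lambda>x m. idt G x) T \<nu> F' \<and> (\<forall>x\<in>Ob G. \<forall>s\<in>S x. F' x s = g x s) \<longrightarrow>
           (\<forall>x\<in>Ob G. \<forall>m\<in>carrier (grp M x). F' x m = F x m))"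
      using L[unfolded free_module_on_def, THEN conjunct2, THEN conjunct2, rule_format,
          of "quotient_family T" g] module_quotient[OF T'] g
      unfolding hom by (simp add: Q_sel grp_families)
  qed
  show ?L if R': ?R
    unfolding free_module_on_def
  proof (intro conjI module_quotient[OF M] allI impI; (elim conjE)?)
    show "\<forall>x\<in>Ob Q. S x \<subseteq> carrier (grp (quotient_family M) x)"
      using R' by (simp add: free_restricted_on_def Q_sel grp_families)
    fix T :: "('o, 'a set, 'u) gfamily" and g
    assume T: "groupoid_module Q T" and g: "\<forall>x\<in>Ob Q. g x \<in> S x \<rightarrow> carrier (grp T x)"
    note P = restricted_pulled[OF T]
    have hom: "gfamily_hom Q (quotient_family M) T f \<longleftrightarrow>
        crossed_module_hom G M (\<lambda>x m. idt G x) (pulled_family T) (\<lambda>x m. idt G x) f" for f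
      unfolding module_hom_iff[OF R P]
      by (rule quotient_hom_iff[OF M]) (simp_all add: grp_families act_pulled)
    have "\<forall>x\<in>Ob G. \<forall>s\<in>S x. g x s \<in> carrier (grp (pulled_family T) x) \<and> idt G x = idt G x"
      using g by (auto simp: Q_sel grp_families)
    then show "\<exists>F. gfamily_hom Q (quotient_family M) T F \<and> (\<forall>x\<in>Ob Q. \<forall>s\<in>S x. F x s = g x s) \<and>
       (\<forall>F'. gfamily_hom Q (quotient_family M) T F' \<and> (\<forall>x\<in>Ob Q. \<forall>s\<in>S x. F' x s = g x s) \<longrightarrow>
           (\<forall>x\<in>Ob Q. \<forall>m\<in>carrier (grp (quotient_family M) x). F' x m = F x m))"
      using R'[unfolded free_restricted_on_def, THEN conjunct2, THEN conjunct2, rule_format,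
          of "pulled_family T" "\<lambda>x m. idt G x" g] P
      unfolding hom by (simp add: Q_sel grp_families)
  qed
qed

end

lemma restricted_False_iff: "restricted_crossed_module False K G M \<mu> \<longleftrightarrow> crossed_module G M \<mu>"
  by (simp add: restricted_crossed_module_def)

text \<open>With the restricted boundary as the given family of functions and the inclusion as
  structure map, the conditions on these hold as soon as \<open>M\<close> is a crossed module;
  otherwise both sides are false.\<close>

lemma free_crossed_module_iff_restricted:
  "free_crossed_module_on U G S \<mu> M \<mu> (\<lambda>x s. s) \<longleftrightarrow> free_restricted_on U False (\<lambda>x. {}) G S M \<mu>"
proof (cases "crossed_module G M \<mu>")
  case True
  then interpret crossed_module G M \<mu> .
  have "\<mu> x s \<in> carrier (vertex_group G x)" if "x \<in> Ob G" "s \<in> carrier (grp M x)" for x s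
    using bdry_closed[OF that] by (simp add: vertex_group_def)
  then have S: "(\<forall>x\<in>Ob G. \<forall>s\<in>S x. \<mu> x s \<in> carrier (vertex_group G x)) \<and>
      (\<forall>x\<in>Ob G. \<forall>s\<in>S x. s \<in> carrier (grp M x)) \<and> P \<longleftrightarrow> (\<forall>x\<in>Ob G. S x \<subseteq> carrier (grp M x)) \<and> P" for P
    by blast
  show ?thesis
    using True
    by (simp only: free_crossed_module_on_def free_restricted_on_def restricted_False_iff simp_thms S)
next
  case False
  then show ?thesis
    by (simp add: free_crossed_module_on_def free_restricted_on_def restricted_crossed_module_def)
qed

section \<open>Freeness in a crossed complex expressed over its groupoid of dimension 1\<close>

context crossed_complex
begin

text \<open>Normality is the boundary rule: the conjugate by \<open>u\<close> of the boundary of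
  \<open>m\<close> is the boundary of the translate of \<open>m\<close> along
  \<open>u\<close>.\<close>

lemma normal_subgroupoid_bd2:
  "normal_subgroupoid (base C) (\<lambda>x. bd2 C x ` carrier (cgrp C 2 x))"
proof -
  interpret crossed_module "base C" "fam C 2" "bd2 C" by (rule dim2_crossed_module)
  show ?thesis
  proof (intro normal_subgroupoid.intro normal_subgroupoid_axioms.intro base_groupoid)
    fix x assume x: "x \<in> Ob (base C)"
    show "bd2 C x ` carrier (cgrp C 2 x) \<subseteq> carrier (vertex_group (base C) x)"
      using bdry_closed[OF x] by (auto simp: vertex_group_def)
    show "idt (base C) x \<in> bd2 C x ` carrier (cgrp C 2 x)"
      using bdry_one[OF x] grp_simps(1)[OF x] by force
    fix k assume "k \<in> bd2 C x ` carrier (cgrp C 2 x)"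
    then obtain m where m: "m \<in> carrier (cgrp C 2 x)" "k = bd2 C x m" by blast
    show "ginv (base C) k \<in> bd2 C x ` carrier (cgrp C 2 x)"
      using bdry_inv[OF x m(1)] grp_simps(3)[OF x m(1)] m(2) by force
    fix h assume "h \<in> bd2 C x ` carrier (cgrp C 2 x)"
    then obtain n where n: "n \<in> carrier (cgrp C 2 x)" "h = bd2 C x n" by blast
    show "cmp (base C) h k \<in> bd2 C x ` carrier (cgrp C 2 x)"
      using bdry_mult[OF x n(1) m(1)] grp_simps(2)[OF x n(1) m(1)] m(2) n(2) by force
  next
    fix u k assume u: "u \<in> Ar (base C)" and "k \<in> bd2 C (src (base C) u) ` carrier (cgrp C 2 (src (base C) u))"
    then obtain m where m: "m \<in> carrier (cgrp C 2 (src (base C) u))" "k = bd2 C (src (base C) u) m" by blast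
    show "cmp (base C) (cmp (base C) (ginv (base C) u) k) u \<in>
        bd2 C (tgt (base C) u) ` carrier (cgrp C 2 (tgt (base C) u))"
      using bdry_act[OF u m(1)] act_closed[OF u m(1)] m(2) by force
  qed
qed

lemma free_module_iff_restricted:
  assumes n: "n \<ge> 3"
  shows "free_module_on TYPE('u) (fundamental_groupoid C) (pi1_family C n) S \<longleftrightarrow>
    free_restricted_on TYPE('u) True (\<lambda>x. bd2 C x ` carrier (cgrp C 2 x)) (base C) S (fam C n) (\<lambda>x m. idt (base C) x)"
    and "restricted_crossed_module True (\<lambda>x. bd2 C x ` carrier (cgrp C 2 x)) (base C) (fam C n) (\<lambda>x m. idt (base C) x)"
proof -
  interpret normal_subgroupoid "base C" "\<lambda>x. bd2 C x ` carrier (cgrp C 2 x)"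
    by (rule normal_subgroupoid_bd2)
  have "acts_trivially (fam C n)" using bd2_act_trivial[OF n] by (auto simp: acts_trivially_def)
  moreover have "pi1_family C n = quotient_family (fam C n)"
    by (simp add: pi1_family_def quotient_family_def)
  ultimately show "free_module_on TYPE('u) (fundamental_groupoid C) (pi1_family C n) S \<longleftrightarrow>
      free_restricted_on TYPE('u) True (\<lambda>x. bd2 C x ` carrier (cgrp C 2 x)) (base C) S (fam C n) (\<lambda>x m. idt (base C) x)"
    "restricted_crossed_module True (\<lambda>x. bd2 C x ` carrier (cgrp C 2 x)) (base C) (fam C n) (\<lambda>x m. idt (base C) x)"
    using free_module_iff_restricted[OF dim_ge3_module[OF n]] dim_ge3_module[OF n]
    by (simp_all add: fundamental_groupoid_def restricted_iff_module)
qed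

end

theorem corollary8p3:
  fixes C' :: "('p, 'b, 'n) crossed_complex"
    and C :: "('o, 'a, 'm) crossed_complex"
    and p :: "('p, 'b, 'n, 'o, 'a, 'm) cc_map"
    and X :: "('o, 'a, 'm) cc_basis"
  assumes "cc_covering C' C p"
    and "free_cc_on TYPE(('o, 'a, 'm) word_universe) C X"
  shows "free_cc_on TYPE('u) C' (cc_preimage C' p X)"
proof -
  note cov = assms(1)[unfolded cc_covering_def cc_morphism_def]
  note free = assms(2)[unfolded free_cc_on_def]
  interpret C': crossed_complex C' using cov by simp
  interpret C: crossed_complex C using cov by simp
  interpret groupoid_cover "base C'" "base C" "map0 p" "map1 p"
    using cov C'.base_groupoid C.base_groupoid
    by (intro groupoid_cover.intro groupoid_cover_axioms.intro) auto
  interpret M': crossed_module "base C'" "fam C' 2" "bd2 C'" by (rule C'.dim2_crossed_module)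
  let ?K' = "\<lambda>x. bd2 C' x ` carrier (cgrp C' 2 x)" and ?K = "\<lambda>x. bd2 C x ` carrier (cgrp C 2 x)"
  have iso: "mapn p n x \<in> iso (cgrp C' n x) (cgrp C n (map0 p x))" if "n \<ge> 2" "x \<in> Ob (base C')" for n x
    using cov that by simp
  have act: "mapn p n (tgt (base C') u) (cact C' n m u) = cact C n (mapn p n (src (base C') u) m) (map1 p u)"
    if "n \<ge> 2" "u \<in> Ar (base C')" "m \<in> carrier (cgrp C' n (src (base C') u))" for n u m
    using cov that by simp
  have bdry: "map1 p (bd2 C' x m) = bd2 C (map0 p x) (mapn p 2 x m)"
    if "x \<in> Ob (base C')" "m \<in> carrier (cgrp C' 2 x)" for x m
    using cov that by simp
  \<comment> \<open>Since \<open>mapn p 2 x'\<close> is onto, a boundary in \<open>C\<close> is the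
    image of a boundary in \<open>C'\<close> at the chosen object, that is, of a loop there.\<close>
  have K_lift: "\<exists>k'\<in>?K' x'. map1 p k' = k" if x': "x' \<in> Ob (base C')" and k: "k \<in> ?K (map0 p x')" for x' k
  proof -
    obtain m where m: "m \<in> carrier (cgrp C 2 (map0 p x'))" "k = bd2 C (map0 p x') m" using k by blast
    then obtain m' where "m' \<in> carrier (cgrp C' 2 x')" "m = mapn p 2 x' m'"
      using iso[OF _ x', of 2] by (auto simp: iso_def bij_betw_def)
    then show ?thesis using bdry[OF x'] m(2) by auto
  qed
  have "free_groupoid_on TYPE(('o, 'a, 'm) word_universe) (base C) (gens1 X)" using free by simp
  then have "free_groupoid_on TYPE('u) (base C') (gens1 (cc_preimage C' p X))"
    unfolding cc_preimage_def cc_basis.select_convs by (rule free_groupoid_covering)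
  moreover have "free_restricted_on TYPE('u) False (\<lambda>x. {}) (base C') (gens (cc_preimage C' p X) 2) (fam C' 2) (bd2 C')"
    unfolding cc_preimage_def cc_basis.select_convs
    \<comment> \<open>Dimension 2 is the case of all crossed modules: with empty \<open>K\<close>,
      the lifting condition is vacuous.\<close>
    by (rule free_restricted_covering[where q = "mapn p 2" and K = "\<lambda>_. {}"])
      (use free iso[of 2] act[of 2] bdry C'.dim2_crossed_module in
        \<open>simp_all add: free_crossed_module_iff_restricted restricted_crossed_module_def\<close>)
  moreover have "free_module_on TYPE('u) (fundamental_groupoid C') (pi1_family C' n) (gens (cc_preimage C' p X) n)"
    if n: "n \<ge> 3" for n
    unfolding C'.free_module_iff_restricted(1)[OF n] cc_preimage_def cc_basis.select_convs
  proof (rule free_restricted_covering[where q = "mapn p n", OF _ C'.free_module_iff_restricted(2)[OF n]])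
    show "free_restricted_on TYPE(('o, 'a, 'm) word_universe) True ?K (base C) (gens X n) (fam C n) (\<lambda>x m. idt (base C) x)"
      using free n by (simp flip: C.free_module_iff_restricted(1)[OF n])
    show "?K x \<subseteq> carrier (vertex_group (base C) x)" if "x \<in> Ob (base C)" for x
      using normal_subgroupoid.N_vertex[OF C.normal_subgroupoid_bd2 that] .
    show "?K' x \<subseteq> carrier (vertex_group (base C') x)" if "x \<in> Ob (base C')" for x
      using normal_subgroupoid.N_vertex[OF C'.normal_subgroupoid_bd2 that] .
    show "\<exists>k'\<in>?K' x'. map1 p k' = k" if "x' \<in> Ob (base C')" "k \<in> ?K (map0 p x')" for x' k
      using K_lift[OF that] .
    show "mapn p n x \<in> iso (cgrp C' n x) (cgrp C n (map0 p x))" if "x \<in> Ob (base C')" for x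
      using iso[of n] n that by simp
    show "mapn p n (tgt (base C') u) (cact C' n m u) = cact C n (mapn p n (src (base C') u) m) (map1 p u)"
      if "u \<in> Ar (base C')" "m \<in> carrier (cgrp C' n (src (base C') u))" for u m
      using act[of n] n that by simp
    \<comment> \<open>The boundaries are constantly the identities in this case, so compatibility
      with \<open>p\<close> is preservation of identities.\<close>
    show "map1 p (idt (base C') x) = idt (base C) (map0 p x)" if "x \<in> Ob (base C')" for x
      using homD(5)[OF that] .
  qed
  ultimately show ?thesis
    using C'.crossed_complex_axioms by (simp add: free_cc_on_def free_crossed_module_iff_restricted)
qed

end
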